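(* Let $\mathbb{L}$ be a layer system over a signature $\mathcal{F}$ and let $\mathcal{R}$ be a TRS over $\mathcal{F}$ that is weakly layered according to $\mathbb{L}$ and confluent on the terms of rank one, i.e. on $\mathbb{L}\cap\mathcal{T}(\mathcal{F},\mathcal{V})$. If $\mathcal{R}$ is bounded duplicating then $\mathcal{R}$ is confluent.
   Context: Let $\mathcal{F}$ be a signature and $\mathcal{V}$ a countably infinite set of variables. Let $\square\notin\mathcal{F}\cup\mathcal{V}$ be a fresh constant (the hole). Contexts are the elements of $\mathcal{C}(\mathcal{F},\mathcal{V})=\mathcal{T}(\mathcal{F}\cup\{\square\},\mathcal{V})$; they may contain any number of holes. The order $\sqsubseteq$ on contexts is the smallest reflexive, transitive, monotone relation with $\square\sqsubseteq C$ for all contexts $C$. $C\sqcup D$ is the least upper bound with respect to $\sqsubseteq$, when it exists. $\mathrm{Pos}_{\mathcal{F}}(C)$ (resp. $\mathrm{Pos}_\square(C)$) is the set of positions of $C$ carrying a symbol of $\mathcal{F}$ (resp. the hole). Rules $\ell\to r$ satisfy $\ell\notin\mathcal{V}$ and $\mathrm{Var}(r)\subseteq\mathrm{Var}(\ell)$. Rewriting is extended to contexts by treating $\square$ as a constant. $s\to_{p,\ell\to r}t$ denotes a step at position $p$ with rule $\ell\to r$. Given $\mathbb{L}\subseteq\mathcal{C}(\mathcal{F},\mathcal{V})$, a top of a context $C$ is an $L\in\mathbb{L}$ with $L\sqsubseteq C$. A max-top of $C$ is a $\sqsubseteq$-maximal top of $C$. $\mathbb{L}$ is a layer system if it satisfies: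 (L1) every term in $\mathcal{T}(\mathcal{F},\mathcal{V})$ has a top different from $\square$; (L2) for $x\in\mathcal{V}$, any context $C$ and position $p$: $C[x]_p\in\mathbb{L}$ iff $C[\square]_p\in\mathbb{L}$; (L3) if $L,N\in\mathbb{L}$, $p\in\mathrm{Pos}_{\mathcal{F}}(L)$ and $L|_p\sqcup N$ is defined, then $L[L|_p\sqcup N]_p\in\mathbb{L}$. A TRS $\mathcal{R}$ is weakly layered according to $\mathbb{L}$ if every rule $\ell\to r\in\mathcal{R}$ satisfies: (W) whenever $M$ is a max-top of a term $s$, $p\in\mathrm{Pos}_{\mathcal{F}}(M)$ and $s\to_{p,\ell\to r}t$, then $M\to_{p,\ell\to r}L$ for some $L\in\mathbb{L}$. A relation is confluent on a set $S$ of terms if $S$ is closed under it and its restriction to $S\times S$ is confluent. Let $\Diamond$ be a fresh unary function symbol. $\mathcal{R}$ is bounded duplicating if the relative TRS $\{\Diamond(x)\to x\}/\mathcal{R}$ is terminating. This means there is no infinite rewrite sequence using $\mathcal{R}\cup\{\Diamond(x)\to x\}$ on terms over $\mathcal{F}\cup\{\Diamond\}$ that contains infinitely many $\Diamond(x)\to x$ steps. *)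

theory Defs
  imports "HOL-Library.Countable_Set" "HOL-Library.Confluence"
begin

datatype (syms_of: 'f, vars_of: 'v) trm = Var 'v | Fun 'f "('f, 'v) trm list"

text \<open>A signature is a set of pairs of a function symbol and its arity. The same name occurring
  with two arities amounts to two distinct function symbols.\<close>

type_synonym 'f sig = "('f \<times> nat) set"

text \<open>The set T(F,V), where V is the whole type of variables.\<close>

inductive_set terms :: "'f sig \<Rightarrow> ('f, 'v) trm set" for F :: "'f sig" where
  Var: "Var x \<in> terms F"
| Fun: "(f, length ts) \<in> F \<Longrightarrow> (\<And>t. t \<in> set ts \<Longrightarrow> t \<in> terms F) \<Longrightarrow> Fun f ts \<in> terms F"

type_synonym pos = "nat list"

primrec poss :: "('f, 'v) trm \<Rightarrow> pos set" where
  "poss (Var x) = {[]}"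
| "poss (Fun f ts) = insert [] {i # p | i p. i < length ts \<and> p \<in> map poss ts ! i}"

text \<open>Subterm at a position and replacement at a position; meaningful only for positions of the
  term.\<close>

primrec subt_at :: "pos \<Rightarrow> ('f, 'v) trm \<Rightarrow> ('f, 'v) trm" where
  "subt_at [] t = t"
| "subt_at (i # p) t = (case t of Var x \<Rightarrow> Var x | Fun f ts \<Rightarrow> subt_at p (ts ! i))"

primrec replace_at :: "pos \<Rightarrow> ('f, 'v) trm \<Rightarrow> ('f, 'v) trm \<Rightarrow> ('f, 'v) trm" where
  "replace_at [] u t = u"
| "replace_at (i # p) u t =
     (case t of Var x \<Rightarrow> Var x | Fun f ts \<Rightarrow> Fun f (ts[i := replace_at p u (ts ! i)]))"

primrec subst :: "('v \<Rightarrow> ('f, 'w) trm) \<Rightarrow> ('f, 'v) trm \<Rightarrow> ('f, 'w) trm" where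
  "subst \<sigma> (Var x) = \<sigma> x"
| "subst \<sigma> (Fun f ts) = Fun f (map (subst \<sigma>) ts)"

type_synonym ('f, 'v) rule = "('f, 'v) trm \<times> ('f, 'v) trm"

type_synonym ('f, 'v) trs = "('f, 'v) rule set"

definition is_trs :: "'f sig \<Rightarrow> ('f, 'v) trs \<Rightarrow> bool" where
  "is_trs F R \<longleftrightarrow> (\<forall>(l, r) \<in> R. l \<in> terms F \<and> r \<in> terms F \<and>
     l \<notin> range Var \<and> vars_of r \<subseteq> vars_of l)"

definition step_at :: "pos \<Rightarrow> ('f, 'v) rule \<Rightarrow> ('f, 'v) trm \<Rightarrow> ('f, 'v) trm \<Rightarrow> bool" where
  "step_at p \<rho> s t \<longleftrightarrow> p \<in> poss s \<and>
     (\<exists>\<sigma>. subt_at p s = subst \<sigma> (fst \<rho>) \<and> t = replace_at p (subst \<sigma> (snd \<rho>)) s)"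

definition rstep :: "'f sig \<Rightarrow> ('f, 'v) trs \<Rightarrow> ('f, 'v) trm \<Rightarrow> ('f, 'v) trm \<Rightarrow> bool" where
  "rstep F R s t \<longleftrightarrow> s \<in> terms F \<and> t \<in> terms F \<and> (\<exists>\<rho> \<in> R. \<exists>p. step_at p \<rho> s t)"

definition confluent_on :: "'a set \<Rightarrow> ('a \<Rightarrow> 'a \<Rightarrow> bool) \<Rightarrow> bool" where
  "confluent_on S r \<longleftrightarrow> (\<forall>s \<in> S. \<forall>t. r s t \<longrightarrow> t \<in> S) \<and>
     confluentp (\<lambda>s t. s \<in> S \<and> t \<in> S \<and> r s t)"

text \<open>Symbols extended by the fresh constant \<open>\<box>\<close>. Contexts are terms over the extended
  signature; terms of T(F,V) are embedded by tagging every function symbol with \<open>HSym\<close>.\<close>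

datatype 'f with_hole = Hole | HSym 'f

definition hole_sig :: "'f sig \<Rightarrow> 'f with_hole sig" where
  "hole_sig F = insert (Hole, 0) (map_prod HSym id ` F)"

type_synonym ('f, 'v) ctxt = "('f with_hole, 'v) trm"

abbreviation ctxts :: "'f sig \<Rightarrow> ('f, 'v) ctxt set" where
  "ctxts F \<equiv> terms (hole_sig F)"

abbreviation hole :: "('f, 'v) ctxt" where
  "hole \<equiv> Fun Hole []"

definition ctxt_of :: "('f, 'v) trm \<Rightarrow> ('f, 'v) ctxt" where
  "ctxt_of t = map_trm HSym id t"

definition ctxt_rule :: "('f, 'v) rule \<Rightarrow> ('f with_hole, 'v) rule" where
  "ctxt_rule \<rho> = map_prod ctxt_of ctxt_of \<rho>"

text \<open>The order \<open>\<sqsubseteq>\<close>; it relates only contexts over \<open>F\<close>, so upper bounds below range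
  over these.\<close>

inductive ctxt_le :: "'f sig \<Rightarrow> ('f, 'v) ctxt \<Rightarrow> ('f, 'v) ctxt \<Rightarrow> bool" for F :: "'f sig" where
  hole: "C \<in> ctxts F \<Longrightarrow> ctxt_le F hole C"
| refl: "C \<in> ctxts F \<Longrightarrow> ctxt_le F C C"
| trans: "ctxt_le F C D \<Longrightarrow> ctxt_le F D E \<Longrightarrow> ctxt_le F C E"
| mono: "ctxt_le F C D \<Longrightarrow> Fun f (Cs @ C # Ds) \<in> ctxts F \<Longrightarrow>
    ctxt_le F (Fun f (Cs @ C # Ds)) (Fun f (Cs @ D # Ds))"

text \<open>\<open>is_ctxt_lub F C D U\<close>: the least upper bound of \<open>C\<close> and \<open>D\<close> is defined and equals \<open>U\<close>.\<close>

definition is_ctxt_lub ::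
    "'f sig \<Rightarrow> ('f, 'v) ctxt \<Rightarrow> ('f, 'v) ctxt \<Rightarrow> ('f, 'v) ctxt \<Rightarrow> bool" where
  "is_ctxt_lub F C D U \<longleftrightarrow> ctxt_le F C U \<and> ctxt_le F D U \<and>
     (\<forall>E. ctxt_le F C E \<and> ctxt_le F D E \<longrightarrow> ctxt_le F U E)"

definition fun_poss :: "('f, 'v) ctxt \<Rightarrow> pos set" where
  "fun_poss C = {p \<in> poss C. \<exists>f Cs. subt_at p C = Fun (HSym f) Cs}"

definition is_top :: "'f sig \<Rightarrow> ('f, 'v) ctxt set \<Rightarrow> ('f, 'v) ctxt \<Rightarrow> ('f, 'v) ctxt \<Rightarrow> bool" where
  "is_top F LL L C \<longleftrightarrow> L \<in> LL \<and> ctxt_le F L C"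

definition is_max_top ::
    "'f sig \<Rightarrow> ('f, 'v) ctxt set \<Rightarrow> ('f, 'v) ctxt \<Rightarrow> ('f, 'v) ctxt \<Rightarrow> bool" where
  "is_max_top F LL M C \<longleftrightarrow> is_top F LL M C \<and>
     (\<forall>N. is_top F LL N C \<and> ctxt_le F M N \<longrightarrow> N = M)"

definition layer_system :: "'f sig \<Rightarrow> ('f, 'v) ctxt set \<Rightarrow> bool" where
  "layer_system F LL \<longleftrightarrow> LL \<subseteq> ctxts F \<and>
     (\<forall>t \<in> terms F. \<exists>L. is_top F LL L (ctxt_of t) \<and> L \<noteq> hole) \<and>
     (\<forall>x. \<forall>C \<in> ctxts F. \<forall>p \<in> poss C.
        replace_at p (Var x) C \<in> LL \<longleftrightarrow> replace_at p hole C \<in> LL) \<and>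
     (\<forall>L \<in> LL. \<forall>N \<in> LL. \<forall>p \<in> fun_poss L. \<forall>U.
        is_ctxt_lub F (subt_at p L) N U \<longrightarrow> replace_at p U L \<in> LL)"

definition weakly_layered :: "'f sig \<Rightarrow> ('f, 'v) ctxt set \<Rightarrow> ('f, 'v) trs \<Rightarrow> bool" where
  "weakly_layered F LL R \<longleftrightarrow> (\<forall>\<rho> \<in> R. \<forall>M p. \<forall>s \<in> terms F. \<forall>t \<in> terms F.
     is_max_top F LL M (ctxt_of s) \<and> p \<in> fun_poss M \<and> step_at p \<rho> s t \<longrightarrow>
     (\<exists>L \<in> LL. step_at p (ctxt_rule \<rho>) M L))"

definition rank_one_terms :: "'f sig \<Rightarrow> ('f, 'v) ctxt set \<Rightarrow> ('f, 'v) trm set" where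
  "rank_one_terms F LL = {t \<in> terms F. ctxt_of t \<in> LL}"

text \<open>Symbols extended by the fresh unary symbol \<open>\<diamond>\<close>.\<close>

datatype 'f with_diamond = Diamond | DSym 'f

definition diamond_sig :: "'f sig \<Rightarrow> 'f with_diamond sig" where
  "diamond_sig F = insert (Diamond, 1) (map_prod DSym id ` F)"

definition diamond_rule :: "'v \<Rightarrow> ('f with_diamond, 'v) rule" where
  "diamond_rule x = (Fun Diamond [Var x], Var x)"

definition diamond_trs :: "('f, 'v) trs \<Rightarrow> ('f with_diamond, 'v) trs" where
  "diamond_trs R = map_prod (map_trm DSym id) (map_trm DSym id) ` R"

text \<open>The set \<open>range diamond_rule\<close> contains the rule \<open>\<diamond>(x) \<rightarrow> x\<close> for every choice of the
  variable \<open>x\<close>; all of these induce the same rewrite steps.\<close>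

definition bounded_duplicating :: "'f sig \<Rightarrow> ('f, 'v) trs \<Rightarrow> bool" where
  "bounded_duplicating F R \<longleftrightarrow> \<not> (\<exists>t :: nat \<Rightarrow> ('f with_diamond, 'v) trm.
     (\<forall>i. rstep (diamond_sig F) (diamond_trs R \<union> range diamond_rule) (t i) (t (Suc i))) \<and>
     (\<exists>\<^sub>\<infinity>i. rstep (diamond_sig F) (range diamond_rule) (t i) (t (Suc i))))"

end

theory Submission
  imports Defs
begin

text \<open>A term \<open>t\<close> has a greatest top \<open>max_top t\<close>; the subterms of \<open>t\<close> at its holes are the aliens
  of \<open>t\<close>. Put a \<open>\<diamond>\<close> on every alien, on every alien of an alien, and so on, to get \<open>mark t\<close>. The
  nesting depth of \<open>\<diamond>\<close> plays the role of the rank. A step \<open>t \<rightarrow> t'\<close> either rewrites the max-top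
  (by (W)) or an alien, and in both cases yields a top \<open>L\<close> of \<open>t'\<close>; if \<open>L\<close> is not \<open>max_top t'\<close>, some
  alien fuses with the layer above it, and \<open>mark t\<close> loses a \<open>\<diamond>\<close>. Hence \<open>\<diamond>(x) \<rightarrow> x\<close> relative to \<open>R\<close>
  provides a well-founded order that decreases with each fusion.

  Confluence at \<open>t\<close> follows by induction on the depth of \<open>mark t\<close> and then on that order. Given a
  peak at \<open>t\<close>, it suffices to join the two sides up to their first fusion. The finitely many aliens
  occurring there have smaller depth, so convertible ones have a common reduct. Replacing each
  class of convertible aliens by a fresh variable gives a peak of rank-one terms. It is joinable, and
  substituting the common reducts for the variables joins the original peak.\<close>

section \<open>Positions, substitutions and steps\<close>

lemma terms_Var [simp]: "Var x \<in> terms F"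
  by (rule terms.Var)

lemma terms_Fun [simp]: "Fun f ts \<in> terms F \<longleftrightarrow> (f, length ts) \<in> F \<and> (\<forall>t\<in>set ts. t \<in> terms F)"
  by (subst terms.simps) auto

lemma poss_Fun_Cons [simp]: "i # p \<in> poss (Fun f ts) \<longleftrightarrow> i < length ts \<and> p \<in> poss (ts ! i)"
  by auto

lemma poss_Nil [simp]: "[] \<in> poss t"
  by (cases t) auto

lemma poss_Cons: "i # p \<in> poss t \<longleftrightarrow> (\<exists>f ts. t = Fun f ts \<and> i < length ts \<and> p \<in> poss (ts ! i))"
  by (cases t) auto

declare poss.simps(2) [simp del]

lemma subt_at_terms: "p \<in> poss t \<Longrightarrow> t \<in> terms F \<Longrightarrow> subt_at p t \<in> terms F"
  by (induction p arbitrary: t) (auto simp: poss_Cons)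

lemma replace_at_terms:
  "p \<in> poss t \<Longrightarrow> t \<in> terms F \<Longrightarrow> u \<in> terms F \<Longrightarrow> replace_at p u t \<in> terms F"
  by (induction p arbitrary: t) (auto simp: poss_Cons dest!: set_update_subset_insert[THEN subsetD])

lemma subt_at_replace_at [simp]: "p \<in> poss t \<Longrightarrow> subt_at p (replace_at p u t) = u"
  by (induction p arbitrary: t) (auto simp: poss_Cons)

lemma poss_replace_at [simp]: "p \<in> poss t \<Longrightarrow> p \<in> poss (replace_at p u t)"
  by (induction p arbitrary: t) (auto simp: poss_Cons)

lemma replace_at_replace_at [simp]:
  "p \<in> poss t \<Longrightarrow> replace_at p u (replace_at p v t) = replace_at p u t"
  by (induction p arbitrary: t) (auto simp: poss_Cons)

lemma replace_at_subt_at [simp]: "p \<in> poss t \<Longrightarrow> replace_at p (subt_at p t) t = t"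
  by (induction p arbitrary: t) (auto simp: poss_Cons)

lemma poss_append: "p @ q \<in> poss t \<longleftrightarrow> p \<in> poss t \<and> q \<in> poss (subt_at p t)"
  by (induction p arbitrary: t) (auto simp: poss_Cons)

lemma subt_at_append: "p \<in> poss t \<Longrightarrow> subt_at (p @ q) t = subt_at q (subt_at p t)"
  by (induction p arbitrary: t) (auto simp: poss_Cons)

lemma replace_at_append:
  "p \<in> poss t \<Longrightarrow> replace_at (p @ q) u t = replace_at p (replace_at q u (subt_at p t)) t"
  by (induction p arbitrary: t) (auto simp: poss_Cons)

lemma poss_subst: "p \<in> poss t \<Longrightarrow> p \<in> poss (subst \<sigma> t)"
  by (induction p arbitrary: t) (auto simp: poss_Cons)

lemma subt_at_subst: "p \<in> poss t \<Longrightarrow> subt_at p (subst \<sigma> t) = subst \<sigma> (subt_at p t)"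
  by (induction p arbitrary: t) (auto simp: poss_Cons)

lemma replace_at_subst:
  "p \<in> poss t \<Longrightarrow> replace_at p (subst \<sigma> u) (subst \<sigma> t) = subst \<sigma> (replace_at p u t)"
  by (induction p arbitrary: t) (auto simp: poss_Cons map_update)

lemma subst_subst: "subst \<sigma> (subst \<tau> t) = subst (\<lambda>x. subst \<sigma> (\<tau> x)) t"
  by (induction t) auto

lemma subst_terms:
  "t \<in> terms F \<Longrightarrow> (\<And>x. x \<in> vars_of t \<Longrightarrow> \<sigma> x \<in> terms F) \<Longrightarrow> subst \<sigma> t \<in> terms F"
  by (induction t) auto

lemma vars_of_subst: "vars_of (subst \<sigma> t) = (\<Union>x\<in>vars_of t. vars_of (\<sigma> x))"
  by (induction t) auto

lemma vars_of_subt_at: "p \<in> poss t \<Longrightarrow> vars_of (subt_at p t) \<subseteq> vars_of t"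
  by (induction p arbitrary: t) (fastforce simp: poss_Cons)+

lemma vars_of_replace_at: "p \<in> poss t \<Longrightarrow> vars_of (replace_at p u t) \<subseteq> vars_of t \<union> vars_of u"
proof (induction p arbitrary: t)
  case (Cons i p)
  then obtain f ts where t: "t = Fun f ts" "i < length ts" "p \<in> poss (ts ! i)"
    by (auto simp: poss_Cons)
  have "vars_of (replace_at (i # p) u t) \<subseteq>
      vars_of (replace_at p u (ts ! i)) \<union> \<Union> (vars_of ` set ts)"
    using t(1) set_update_subset_insert[of ts i "replace_at p u (ts ! i)"] by fastforce
  then show ?case
    using Cons.IH[OF t(3)] t(1,2) nth_mem[OF t(2)] by fastforce
qed simp

lemma finite_vars_of: "finite (vars_of t)"
  by (induction t) auto

section \<open>Steps under replacement and substitution\<close>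

lemma step_at_replace_at:
  assumes "step_at p \<rho> s t" "q \<in> poss u"
  shows "step_at (q @ p) \<rho> (replace_at q s u) (replace_at q t u)"
  using assms by (auto simp: step_at_def poss_append subt_at_append replace_at_append)

lemma step_at_subst:
  assumes "step_at p \<rho> s t"
  shows "step_at p \<rho> (subst \<sigma> s) (subst \<sigma> t)"
  using assms by (auto simp: step_at_def poss_subst subt_at_subst subst_subst
      simp flip: replace_at_subst)

lemma vars_of_step_at:
  assumes "step_at p \<rho> s t" "vars_of (snd \<rho>) \<subseteq> vars_of (fst \<rho>)"
  shows "vars_of t \<subseteq> vars_of s"
proof -
  obtain \<sigma> where p: "p \<in> poss s" and s: "subt_at p s = subst \<sigma> (fst \<rho>)"
    and t: "t = replace_at p (subst \<sigma> (snd \<rho>)) s"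
    using assms(1) by (auto simp: step_at_def)
  have "vars_of (subst \<sigma> (snd \<rho>)) \<subseteq> vars_of (subst \<sigma> (fst \<rho>))"
    using assms(2) by (auto simp: vars_of_subst)
  also have "\<dots> \<subseteq> vars_of s"
    using vars_of_subt_at[OF p] s by simp
  finally show ?thesis
    using vars_of_replace_at[OF p] t by blast
qed

lemma rstep_replace_at:
  assumes "rstep F R s t" "u \<in> terms F" "q \<in> poss u"
  shows "rstep F R (replace_at q s u) (replace_at q t u)"
  using assms step_at_replace_at by (fastforce simp: rstep_def replace_at_terms)

lemma rstep_subst:
  assumes "rstep F R s t" "\<And>x. \<sigma> x \<in> terms F"
  shows "rstep F R (subst \<sigma> s) (subst \<sigma> t)"
  using assms step_at_subst by (fastforce simp: rstep_def subst_terms)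

lemma rsteps_replace_at:
  assumes "(rstep F R)\<^sup>*\<^sup>* s t" "u \<in> terms F" "q \<in> poss u"
  shows "(rstep F R)\<^sup>*\<^sup>* (replace_at q s u) (replace_at q t u)"
  using assms(1) by induction (auto intro: rtranclp.rtrancl_into_rtrancl rstep_replace_at[OF _ assms(2,3)])

lemma rsteps_subst:
  assumes "(rstep F R)\<^sup>*\<^sup>* s t" "\<And>x. \<sigma> x \<in> terms F"
  shows "(rstep F R)\<^sup>*\<^sup>* (subst \<sigma> s) (subst \<sigma> t)"
  using assms(1) by induction (auto intro: rtranclp.rtrancl_into_rtrancl rstep_subst[OF _ assms(2)])

lemma rsteps_terms: "(rstep F R)\<^sup>*\<^sup>* s t \<Longrightarrow> s \<in> terms F \<Longrightarrow> t \<in> terms F"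
  by (induction rule: rtranclp_induct) (auto simp: rstep_def)

text \<open>The arguments are rewritten one after the other. The prefix \<open>ps\<close> holds
  those already treated, so that the induction can run over the rest.\<close>

lemma rsteps_Fun:
  assumes "list_all2 (rstep F R)\<^sup>*\<^sup>* ts us" "Fun f (ps @ ts) \<in> terms F"
  shows "(rstep F R)\<^sup>*\<^sup>* (Fun f (ps @ ts)) (Fun f (ps @ us))"
  using assms
proof (induction arbitrary: ps rule: list_all2_induct)
  case (Cons t ts u us)
  have "(rstep F R)\<^sup>*\<^sup>* (replace_at [length ps] t (Fun f (ps @ t # ts)))
      (replace_at [length ps] u (Fun f (ps @ t # ts)))"
    by (rule rsteps_replace_at) (use Cons in auto)
  then have "(rstep F R)\<^sup>*\<^sup>* (Fun f (ps @ t # ts)) (Fun f (ps @ u # ts))"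
    by simp
  moreover have "Fun f ((ps @ [u]) @ ts) \<in> terms F"
    using Cons.prems rsteps_terms[OF Cons.hyps(1)] by auto
  from Cons.IH[OF this] have "(rstep F R)\<^sup>*\<^sup>* (Fun f (ps @ u # ts)) (Fun f (ps @ u # us))"
    by simp
  ultimately show ?case
    by (rule rtranclp_trans)
qed simp

lemma rsteps_args:
  assumes "length ts = length us" "\<And>i. i < length us \<Longrightarrow> (rstep F R)\<^sup>*\<^sup>* (ts ! i) (us ! i)"
    "Fun f ts \<in> terms F"
  shows "(rstep F R)\<^sup>*\<^sup>* (Fun f ts) (Fun f us)"
  using rsteps_Fun[of F R ts us f "[]"] assms by (auto simp: list_all2_conv_all_nth)

lemma rstep_mono: "rstep F R s t \<Longrightarrow> R \<subseteq> R' \<Longrightarrow> rstep F R' s t"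
  by (auto simp: rstep_def)

lemma rsteps_mono: "(rstep F R)\<^sup>*\<^sup>* s t \<Longrightarrow> R \<subseteq> R' \<Longrightarrow> (rstep F R')\<^sup>*\<^sup>* s t"
  by (rule mono_rtranclp[rule_format, where x="rstep F R"]) (auto dest: rstep_mono)

section \<open>Contexts\<close>

text \<open>A syntax-directed form of \<open>ctxt_le\<close>. Having neither a transitivity rule nor
  a signature, it allows case analysis on either argument; \<open>ctxt_le_iff\<close> relates the
  two.\<close>

inductive hole_le :: "('f, 'v) ctxt \<Rightarrow> ('f, 'v) ctxt \<Rightarrow> bool" where
  hole: "hole_le hole D"
| Var: "hole_le (Var x) (Var x)"
| Fun: "length Cs = length Ds \<Longrightarrow> (\<And>i. i < length Ds \<Longrightarrow> hole_le (Cs ! i) (Ds ! i)) \<Longrightarrow>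
    hole_le (Fun (HSym f) Cs) (Fun (HSym f) Ds)"

inductive_simps hole_le_hole_right: "hole_le C hole"
inductive_simps hole_le_Var_right: "hole_le C (Var x)"
inductive_simps hole_le_Fun_right: "hole_le C (Fun (HSym f) Ds)"
inductive_simps hole_le_Fun_left: "hole_le (Fun (HSym f) Cs) D"
inductive_simps hole_le_Fun_Fun: "hole_le (Fun (HSym f) Cs) (Fun (HSym f) Ds)"

lemma hole_le_trans: "hole_le C D \<Longrightarrow> hole_le D E \<Longrightarrow> hole_le C E"
proof (induction C D arbitrary: E rule: hole_le.induct)
  case (Fun Cs Ds f)
  from Fun.prems show ?case
    by (cases rule: hole_le.cases) (auto intro!: hole_le.Fun Fun.IH simp: Fun.hyps)
qed (auto intro: hole_le.intros)

lemma hole_le_refl_left: "hole_le C D \<Longrightarrow> hole_le C C"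
  by (induction rule: hole_le.induct) (auto intro: hole_le.intros)

lemma hole_le_antisym: "hole_le C D \<Longrightarrow> hole_le D C \<Longrightarrow> C = D"
  by (induction rule: hole_le.induct) (auto simp: hole_le_hole_right hole_le_Fun_left intro: nth_equalityI)

lemma hole_sig_simps [simp]: "(Hole, n) \<in> hole_sig F \<longleftrightarrow> n = 0" "(HSym f, n) \<in> hole_sig F \<longleftrightarrow> (f, n) \<in> F"
  by (force simp: hole_sig_def)+

lemma hole_le_ctxts: "hole_le C D \<Longrightarrow> D \<in> ctxts F \<Longrightarrow> C \<in> ctxts F"
proof (induction rule: hole_le.induct)
  case (Fun Cs Ds f)
  then show ?case
    by (simp add: all_set_conv_all_nth)
qed auto

lemma hole_le_refl: "C \<in> ctxts F \<Longrightarrow> hole_le C C"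
proof (induction C)
  case (Fun g Cs)
  then show ?case
    by (cases g) (auto intro: hole_le.intros)
qed (auto intro: hole_le.intros)

lemma ctxt_le_imp_hole_le: "ctxt_le F C D \<Longrightarrow> hole_le C D \<and> D \<in> ctxts F"
proof (induction rule: ctxt_le.induct)
  case (mono C D f Cs Ds)
  \<comment> \<open>\<open>Hole\<close> has arity 0 in \<open>hole_sig F\<close>, so it cannot have
    \<open>C\<close> as an argument.\<close>
  have *: "f \<noteq> Hole"
    using mono.hyps by auto
  then obtain g where "f = HSym g"
    by (cases f) auto
  moreover have "\<And>E. E \<in> set (Cs @ Ds) \<Longrightarrow> hole_le E E"
    using mono.hyps by (auto intro: hole_le_refl)
  ultimately show ?case
    using mono by (auto intro!: hole_le.Fun simp: nth_append nth_Cons split: nat.split intro: hole_le_ctxts)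
qed (auto intro: hole_le.hole hole_le_refl hole_le_trans)

lemma ctxt_le_Fun:
  assumes "list_all2 (ctxt_le F) Cs Ds" "Fun f (Bs @ Ds) \<in> ctxts F"
  shows "ctxt_le F (Fun f (Bs @ Cs)) (Fun f (Bs @ Ds))"
  using assms
proof (induction arbitrary: Bs rule: list_all2_induct)
  case Nil
  then show ?case by (simp add: ctxt_le.refl)
next
  case (Cons C Cs D Ds)
  have "Fun f (Bs @ C # Ds) \<in> ctxts F"
    using Cons.prems ctxt_le_imp_hole_le[OF Cons.hyps(1)] by (auto intro: hole_le_ctxts)
  then show ?case
    using Cons.IH[of "Bs @ [C]"] ctxt_le.mono[OF Cons.hyps(1), of f Bs Ds]
    by (auto intro: ctxt_le.trans)
qed

lemma hole_le_imp_ctxt_le: "hole_le C D \<Longrightarrow> D \<in> ctxts F \<Longrightarrow> ctxt_le F C D"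
proof (induction rule: hole_le.induct)
  case (Fun Cs Ds f)
  then show ?case
    using ctxt_le_Fun[of F Cs Ds "HSym f" "[]"] by (auto simp: list_all2_conv_all_nth)
qed (auto intro: ctxt_le.intros)

lemma ctxt_le_iff: "ctxt_le F C D \<longleftrightarrow> hole_le C D \<and> D \<in> ctxts F"
  using ctxt_le_imp_hole_le hole_le_imp_ctxt_le by blast

lemma hole_le_replace_at:
  assumes "hole_le C D" "p \<in> poss C" "hole_le A B"
  shows "hole_le (replace_at p A C) (replace_at p B D)"
  using assms(1,2)
proof (induction p arbitrary: C D)
  case (Cons i p)
  from Cons.prems show ?case
    by cases (use Cons in \<open>auto simp: nth_list_update hole_le_Fun_Fun\<close>)
qed (use assms(3) in auto)

section \<open>Least upper bounds of contexts\<close>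

lemma size_nth_less [termination_simp]: "i < length ts \<Longrightarrow> size (ts ! i) < Suc (size_list size ts)"
  using size_list_estimation'[of "ts ! i" ts "size (ts ! i)" size] by simp

text \<open>The least upper bound of contexts that have a common upper bound; for others the value
  has no meaning. The last equation also handles a hole on the right.\<close>

fun merge :: "('f, 'v) ctxt \<Rightarrow> ('f, 'v) ctxt \<Rightarrow> ('f, 'v) ctxt" where
  "merge (Fun Hole Cs) D = D"
| "merge (Fun (HSym f) Cs) (Fun (HSym g) Ds) =
    Fun (HSym f) (map (\<lambda>i. merge (Cs ! i) (Ds ! i)) [0..<length Cs])"
| "merge C D = C"

text \<open>Two contexts below \<open>E\<close> cannot clash: where neither has a hole, both carry
  the symbol of \<open>E\<close>.\<close>

lemma merge_lub:
  "hole_le C E \<Longrightarrow> hole_le D E \<Longrightarrow> hole_le C (merge C D) \<and> hole_le D (merge C D) \<and> hole_le (merge C D) E"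
proof (induction arbitrary: D rule: hole_le.induct)
  case (Fun Cs Es f)
  from Fun.prems show ?case
  proof (cases rule: hole_le.cases)
    case hole
    then show ?thesis
      using Fun.hyps hole_le_refl_left[OF hole_le.Fun[OF Fun.hyps]] by (auto intro: hole_le.intros)
  next
    case (Fun Ds)
    then show ?thesis
      using Fun.IH Fun.hyps by (auto simp: hole_le_Fun_Fun)
  qed
qed (auto intro: hole_le.intros simp: hole_le_Var_right dest: hole_le_refl_left)

text \<open>Two tops of a term are both below that term, so this makes the least upper bound in (L3)
  available for them.\<close>

lemma is_ctxt_lub_merge:
  assumes "hole_le C E" "hole_le D E" "E \<in> ctxts F"
  shows "is_ctxt_lub F C D (merge C D)"
  using assms merge_lub hole_le_ctxts unfolding is_ctxt_lub_def ctxt_le_iff by blast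

text \<open>\<open>matches C t\<close> means \<open>C \<sqsubseteq> t\<close>, with \<open>t\<close> not yet embedded into the contexts.\<close>

inductive matches :: "('f, 'v) ctxt \<Rightarrow> ('f, 'v) trm \<Rightarrow> bool" where
  hole: "matches hole t"
| Var: "matches (Var x) (Var x)"
| Fun: "length Cs = length ts \<Longrightarrow> (\<And>i. i < length ts \<Longrightarrow> matches (Cs ! i) (ts ! i)) \<Longrightarrow>
    matches (Fun (HSym f) Cs) (Fun f ts)"

inductive_simps matches_Fun_Fun: "matches (Fun (HSym f) Cs) (Fun g ts)"
inductive_simps matches_Fun_left: "matches (Fun (HSym f) Cs) t"

lemma ctxt_of_simps [simp]: "ctxt_of (Var x) = Var x" "ctxt_of (Fun f ts) = Fun (HSym f) (map ctxt_of ts)"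
  by (auto simp: ctxt_of_def)

lemma ctxt_of_terms: "t \<in> terms F \<Longrightarrow> ctxt_of t \<in> ctxts F"
  by (induction t) auto

lemma matches_imp_hole_le: "matches C t \<Longrightarrow> hole_le C (ctxt_of t)"
  by (induction rule: matches.induct) (auto intro: hole_le.intros)

lemma hole_le_imp_matches: "hole_le C (ctxt_of t) \<Longrightarrow> matches C t"
proof (induction t arbitrary: C)
  case (Var x)
  then show ?case by (auto simp: hole_le_Var_right intro: matches.intros)
next
  case (Fun f ts)
  then show ?case by (auto simp: hole_le_Fun_right intro!: matches.intros)
qed

lemma matches_iff: "matches C t \<longleftrightarrow> hole_le C (ctxt_of t)"
  using matches_imp_hole_le hole_le_imp_matches by blast

lemma hole_le_matches: "hole_le C D \<Longrightarrow> matches D t \<Longrightarrow> matches C t"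
  by (auto simp: matches_iff intro: hole_le_trans)

section \<open>Aliens and their replacement\<close>

fun aliens :: "('f, 'v) ctxt \<Rightarrow> ('f, 'v) trm \<Rightarrow> ('f, 'v) trm set" where
  "aliens (Fun Hole Cs) t = {t}"
| "aliens (Fun (HSym f) Cs) (Fun g ts) = (\<Union>i<length Cs. aliens (Cs ! i) (ts ! i))"
| "aliens C t = {}"

lemma aliens_nth:
  "s \<in> aliens (Cs ! i) (ts ! i) \<Longrightarrow> i < length Cs \<Longrightarrow> s \<in> aliens (Fun (HSym f) Cs) (Fun g ts)"
  by auto

text \<open>Different choices of \<open>d\<close> and \<open>h\<close> mark the aliens with
  diamonds, name them by variables or replace them by reducts. The function \<open>h\<close> sees an
  alien but not its position, so equal aliens are treated alike and matches of non-left-linear rules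
  survive.\<close>

fun fill :: "('f \<Rightarrow> 'g) \<Rightarrow> (('f, 'v) trm \<Rightarrow> ('g, 'v) trm) \<Rightarrow>
    ('f, 'v) ctxt \<Rightarrow> ('f, 'v) trm \<Rightarrow> ('g, 'v) trm" where
  "fill d h (Fun Hole Cs) t = h t"
| "fill d h (Fun (HSym f) Cs) (Fun g ts) =
    Fun (d g) (map (\<lambda>i. fill d h (Cs ! i) (ts ! i)) [0..<length Cs])"
| "fill d h C t = map_trm d id t"

text \<open>Shows the function package that \<open>mark\<close> calls itself only on aliens.\<close>

lemma fill_cong [fundef_cong]:
  "C = C' \<Longrightarrow> t = t' \<Longrightarrow> (\<And>s. s \<in> aliens C' t' \<Longrightarrow> h s = h' s) \<Longrightarrow> fill d h C t = fill d h' C' t'"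
proof (induction C t arbitrary: C' t' rule: aliens.induct)
  case (2 f Cs g ts)
  have "fill d h (Cs ! i) (ts ! i) = fill d h' (Cs ! i) (ts ! i)" if "i < length Cs" for i
  proof (rule "2.IH"[OF _ HOL.refl HOL.refl])
    fix s assume "s \<in> aliens (Cs ! i) (ts ! i)"
    then show "h s = h' s"
      using that by (intro "2.prems"(3)) (auto simp flip: "2.prems"(1,2))
  qed (use that in auto)
  then show ?case
    by (auto simp flip: "2.prems"(1,2))
qed auto

lemma finite_aliens: "finite (aliens C t)"
  by (induction C t rule: aliens.induct) auto

lemma aliens_terms: "matches C t \<Longrightarrow> t \<in> terms F \<Longrightarrow> s \<in> aliens C t \<Longrightarrow> s \<in> terms F"
  by (induction rule: matches.induct) auto

text \<open>Unless \<open>C\<close> is the hole, where the alien is the whole term, a function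
  symbol sits above every alien. This gives the termination of \<open>mark\<close>.\<close>

lemma aliens_size: "matches C t \<Longrightarrow> s \<in> aliens C t \<Longrightarrow> size s \<le> size t \<and> (C \<noteq> hole \<longrightarrow> size s < size t)"
proof (induction rule: matches.induct)
  case (Fun Cs ts f)
  then obtain i where i: "i < length ts" "s \<in> aliens (Cs ! i) (ts ! i)"
    by auto
  then have "size s \<le> size (ts ! i)"
    using Fun.IH by auto
  also have "\<dots> < size (Fun f ts)"
    using i size_nth_less by simp
  finally show ?case by simp
qed auto

lemma fill_terms:
  assumes "matches C t" "t \<in> terms F" "\<And>s. s \<in> aliens C t \<Longrightarrow> h s \<in> terms G"
    "\<And>f n. (f, n) \<in> F \<Longrightarrow> (d f, n) \<in> G"
  shows "fill d h C t \<in> terms G"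
  using assms(1-3)
proof (induction rule: matches.induct)
  case (Fun Cs ts f)
  have "fill d h (Cs ! i) (ts ! i) \<in> terms G" if "i < length ts" for i
  proof (rule Fun.IH[OF that])
    fix s assume "s \<in> aliens (Cs ! i) (ts ! i)"
    then show "h s \<in> terms G"
      using that Fun.hyps by (intro Fun.prems(2) aliens_nth[of _ _ i]) auto
  qed (use that Fun.prems(1) in auto)
  then show ?case
    using Fun by (auto simp: assms(4))
qed auto

lemma matches_args_at:
  assumes "matches C t" "i # p \<in> poss C"
  obtains f Cs ts where "C = Fun (HSym f) Cs" "t = Fun f ts" "length Cs = length ts" "i < length ts"
    "p \<in> poss (Cs ! i)" "\<And>i. i < length ts \<Longrightarrow> matches (Cs ! i) (ts ! i)"
  using assms by (auto simp: poss_Cons elim: matches.cases)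

lemma matches_at:
  assumes "matches C t" "p \<in> poss C"
  shows "p \<in> poss t \<and> matches (subt_at p C) (subt_at p t) \<and> aliens (subt_at p C) (subt_at p t) \<subseteq> aliens C t"
  using assms
proof (induction p arbitrary: C t)
  case (Cons i p)
  from Cons.prems show ?case
  proof (rule matches_args_at)
    fix f Cs ts
    assume *: "C = Fun (HSym f) Cs" "t = Fun f ts" "length Cs = length ts" "i < length ts"
      "p \<in> poss (Cs ! i)" "\<And>i. i < length ts \<Longrightarrow> matches (Cs ! i) (ts ! i)"
    then show ?thesis
      using Cons.IH[of "Cs ! i" "ts ! i"] by auto
  qed
qed auto

lemma fill_at:
  assumes "matches C t" "p \<in> poss C"
  shows "p \<in> poss (fill d h C t) \<and> subt_at p (fill d h C t) = fill d h (subt_at p C) (subt_at p t)"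
  using assms
proof (induction p arbitrary: C t)
  case (Cons i p)
  from Cons.prems show ?case
    by (rule matches_args_at) (use Cons.IH in auto)
qed auto

lemma matches_replace_at:
  assumes "matches C t" "p \<in> poss C" "matches A u"
  shows "matches (replace_at p A C) (replace_at p u t) \<and>
    aliens (replace_at p A C) (replace_at p u t) \<subseteq> aliens C t \<union> aliens A u"
  using assms
proof (induction p arbitrary: C t)
  case (Cons i p)
  from Cons.prems(1,2) show ?case
  proof (rule matches_args_at)
    fix f Cs ts
    assume *: "C = Fun (HSym f) Cs" "t = Fun f ts" "length Cs = length ts" "i < length ts"
      "p \<in> poss (Cs ! i)" "\<And>i. i < length ts \<Longrightarrow> matches (Cs ! i) (ts ! i)"
    note IH = Cons.IH[of "Cs ! i" "ts ! i"]
    have "aliens (replace_at (i # p) A C) (replace_at (i # p) u t) \<subseteq> aliens C t \<union> aliens A u"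
      using IH * assms(3) by (fastforce simp: nth_list_update split: if_splits)
    moreover have "matches (replace_at (i # p) A C) (replace_at (i # p) u t)"
      using IH * assms(3) by (auto simp: nth_list_update matches_Fun_Fun)
    ultimately show ?thesis by blast
  qed
qed auto

lemma fill_replace_at:
  assumes "matches C t" "p \<in> poss C" "matches A u"
  shows "fill d h (replace_at p A C) (replace_at p u t) = replace_at p (fill d h A u) (fill d h C t)"
  using assms
proof (induction p arbitrary: C t)
  case (Cons i p)
  from Cons.prems(1,2) show ?case
    by (rule matches_args_at) (use Cons in \<open>auto simp: nth_list_update intro!: nth_equalityI\<close>)
qed auto

lemma matches_subst:
  assumes "matches (subst \<beta> (ctxt_of l)) (subst \<tau> l)" "x \<in> vars_of l"
  shows "matches (\<beta> x) (\<tau> x)"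
  using assms
proof (induction l)
  case (Fun f ls)
  then show ?case by (fastforce simp: matches_Fun_Fun in_set_conv_nth)
qed auto

lemma subst_matches:
  assumes "\<And>x. x \<in> vars_of l \<Longrightarrow> matches (\<beta> x) (\<tau> x)"
  shows "matches (subst \<beta> (ctxt_of l)) (subst \<tau> l)"
  using assms
proof (induction l)
  case (Fun f ls)
  have "matches (subst \<beta> (ctxt_of (ls ! i))) (subst \<tau> (ls ! i))" if "i < length ls" for i
  proof (rule Fun.IH)
    fix x assume "x \<in> vars_of (ls ! i)"
    then show "matches (\<beta> x) (\<tau> x)"
      using that by (intro Fun.prems) auto
  qed (use that in auto)
  then show ?case by (auto simp: matches_Fun_Fun)
qed auto

lemma fill_subst:
  "fill d h (subst \<beta> (ctxt_of l)) (subst \<tau> l) = subst (\<lambda>x. fill d h (\<beta> x) (\<tau> x)) (map_trm d id l)"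
proof (induction l)
  case (Fun f ls)
  then show ?case by (auto intro!: nth_equalityI)
qed auto

lemma aliens_subst:
  "aliens (subst \<beta> (ctxt_of l)) (subst \<tau> l) = (\<Union>x\<in>vars_of l. aliens (\<beta> x) (\<tau> x))"
proof (induction l)
  case (Fun f ls)
  then show ?case by (force simp: set_conv_nth)
qed auto

text \<open>In the instance of \<open>l\<close>, all occurrences of a variable \<open>x\<close>
  carry the same context \<open>\<beta> x\<close> and the same term \<open>\<tau> x\<close>. They
  are therefore filled alike, and the rule still matches even if it is not left-linear. Aliens of
  the contractum come from variables of \<open>r\<close>, which occur in \<open>l\<close>, so none
  is new.\<close>

lemma step_at_fill:
  assumes "step_at p (l, r) t t'" "step_at p (ctxt_rule (l, r)) C D" "matches C t"
    "vars_of r \<subseteq> vars_of l"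
  shows "matches D t'" "aliens D t' \<subseteq> aliens C t"
    "step_at p (map_trm d id l, map_trm d id r) (fill d h C t) (fill d h D t')"
proof -
  obtain \<tau> where \<tau>: "subt_at p t = subst \<tau> l" "t' = replace_at p (subst \<tau> r) t"
    using assms(1) by (auto simp: step_at_def)
  obtain \<beta> where p: "p \<in> poss C" and \<beta>: "subt_at p C = subst \<beta> (ctxt_of l)"
    "D = replace_at p (subst \<beta> (ctxt_of r)) C"
    using assms(2) by (auto simp: step_at_def ctxt_rule_def)
  note at = matches_at[OF assms(3) p]
  have l: "matches (subst \<beta> (ctxt_of l)) (subst \<tau> l)"
    using at \<beta>(1) \<tau>(1) by simp
  have r: "matches (subst \<beta> (ctxt_of r)) (subst \<tau> r)"
    by (rule subst_matches) (use matches_subst[OF l] assms(4) in blast)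
  note rep = matches_replace_at[OF assms(3) p r]
  show "matches D t'"
    using rep \<beta> \<tau> by auto
  have "aliens (subst \<beta> (ctxt_of r)) (subst \<tau> r) \<subseteq> aliens C t"
    using at \<beta>(1) \<tau>(1) assms(4) by (fastforce simp: aliens_subst)
  then show "aliens D t' \<subseteq> aliens C t"
    using rep \<beta> \<tau> by auto
  show "step_at p (map_trm d id l, map_trm d id r) (fill d h C t) (fill d h D t')"
    using fill_at[OF assms(3) p, of d h] fill_replace_at[OF assms(3) p r, of d h] \<beta> \<tau>
    by (auto simp: step_at_def fill_subst)
qed

lemma rsteps_fill:
  assumes "matches C t" "t \<in> terms F" "\<And>s. s \<in> aliens C t \<Longrightarrow> (rstep F R)\<^sup>*\<^sup>* s (h s)"
  shows "(rstep F R)\<^sup>*\<^sup>* t (fill id h C t)"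
  using assms
proof (induction rule: matches.induct)
  case (Fun Cs ts f)
  have "(rstep F R)\<^sup>*\<^sup>* (ts ! i) (fill id h (Cs ! i) (ts ! i))" if "i < length ts" for i
  proof (rule Fun.IH[OF that])
    fix s assume "s \<in> aliens (Cs ! i) (ts ! i)"
    then show "(rstep F R)\<^sup>*\<^sup>* s (h s)"
      using that Fun.hyps by (intro Fun.prems(2) aliens_nth[of _ _ i]) auto
  qed (use that Fun.prems(1) in auto)
  then show ?case
    using Fun.hyps Fun.prems(1) by (auto intro!: rsteps_args simp: id_def)
qed (auto simp: trm.map_id)

text \<open>Undoes the naming of aliens by the variables \<open>x s\<close>. The last assumption
  protects the variables of \<open>t\<close>, which is why the names are chosen fresh later.\<close>

lemma subst_fill:
  assumes "matches C t" "\<And>s. s \<in> aliens C t \<Longrightarrow> \<sigma> (x s) = h s" "\<And>y. y \<in> vars_of t \<Longrightarrow> \<sigma> y = Var y"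
  shows "subst \<sigma> (fill id (\<lambda>s. Var (x s)) C t) = fill id h C t"
  using assms
proof (induction rule: matches.induct)
  case (Fun Cs ts f)
  have "subst \<sigma> (fill id (\<lambda>s. Var (x s)) (Cs ! i) (ts ! i)) = fill id h (Cs ! i) (ts ! i)"
    if "i < length ts" for i
  proof (rule Fun.IH[OF that])
    fix s assume "s \<in> aliens (Cs ! i) (ts ! i)"
    then show "\<sigma> (x s) = h s"
      using that Fun.hyps by (intro Fun.prems(1) aliens_nth[of _ _ i]) auto
  next
    fix y assume "y \<in> vars_of (ts ! i)"
    then show "\<sigma> y = Var y"
      using that by (intro Fun.prems(2)) auto
  qed
  then show ?case
    using Fun.hyps by (auto simp: id_def)
qed auto

text \<open>Serves to locate a redex: as no left-hand side is a variable, it lies in the layer or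
  inside an alien.\<close>

lemma poss_cases:
  assumes "matches C t" "p \<in> poss t"
  obtains "p \<in> fun_poss C" | "\<exists>y. subt_at p t = Var y"
  | q p' where "p = q @ p'" "q \<in> poss C" "subt_at q C = hole" "p' \<in> poss (subt_at q t)"
proof -
  have "p \<in> fun_poss C \<or> (\<exists>y. subt_at p t = Var y) \<or>
    (\<exists>q p'. p = q @ p' \<and> q \<in> poss C \<and> subt_at q C = hole \<and> p' \<in> poss (subt_at q t))"
    using assms
  proof (induction arbitrary: p rule: matches.induct)
    case (Fun Cs ts f)
    show ?case
    proof (cases p)
      case Nil
      then show ?thesis by (auto simp: fun_poss_def)
    next
      case (Cons i p')
      then have i: "i < length ts" "p' \<in> poss (ts ! i)"
        using Fun.prems by auto
      from Fun.IH[OF this] show ?thesis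
      proof (elim disjE exE conjE)
        fix q q'
        assume "p' = q @ q'" "q \<in> poss (Cs ! i)" "subt_at q (Cs ! i) = hole"
          "q' \<in> poss (subt_at q (ts ! i))"
        then show ?thesis
          using Cons i Fun.hyps by (intro disjI2 exI[of _ "i # q"] exI[of _ q']) auto
      qed (use Cons i Fun.hyps in \<open>auto simp: fun_poss_def\<close>)
    qed
  next
    case (hole t)
    then show ?case by (intro disjI2 exI[of _ "[]"] exI[of _ p]) auto
  qed auto
  then show ?thesis
    using that by blast
qed

section \<open>Nested diamonds\<close>

primrec diamond_depth :: "('f with_diamond, 'v) trm \<Rightarrow> nat" where
  "diamond_depth (Var x) = 0"
| "diamond_depth (Fun f ts) = (if f = Diamond then 1 else 0) + Max (insert 0 (set (map diamond_depth ts)))"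

lemma diamond_depth_DSym_le: "diamond_depth (Fun (DSym f) ts) \<le> n \<longleftrightarrow> (\<forall>t\<in>set ts. diamond_depth t \<le> n)"
  by simp

lemma diamond_depth_arg_le: "t \<in> set ts \<Longrightarrow> diamond_depth t \<le> diamond_depth (Fun f ts)"
  using Max_ge[of "insert 0 (diamond_depth ` set ts)" "diamond_depth t"] by (simp add: le_SucI)

text \<open>No symbol of \<open>l\<close> becomes a diamond, so the depth comes from the substituted
  terms alone. With a bound \<open>n\<close> in place of an equation, the two sides of a rule can be
  compared through their variables.\<close>

lemma diamond_depth_subst_le:
  "diamond_depth (subst \<sigma> (map_trm DSym id l)) \<le> n \<longleftrightarrow> (\<forall>x\<in>vars_of l. diamond_depth (\<sigma> x) \<le> n)"
  by (induction l) (auto simp del: diamond_depth.simps(2) simp: diamond_depth_DSym_le)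

lemma diamond_depth_replace_at: "p \<in> poss t \<Longrightarrow> diamond_depth u \<le> diamond_depth (subt_at p t) \<Longrightarrow> diamond_depth (replace_at p u t) \<le> diamond_depth t"
proof (induction p arbitrary: t)
  case (Cons i p)
  then obtain f ts where t: "t = Fun f ts" "i < length ts" "p \<in> poss (ts ! i)"
    by (auto simp: poss_Cons)
  have IH: "diamond_depth (replace_at p u (ts ! i)) \<le> diamond_depth (ts ! i)"
    using Cons t by simp
  have "diamond_depth v \<le> Max (insert 0 (diamond_depth ` set ts))" if "v \<in> set (ts[i := replace_at p u (ts ! i)])" for v
  proof -
    from that obtain w where "w \<in> set ts" "diamond_depth v \<le> diamond_depth w"
      using set_update_subset_insert[of ts i "replace_at p u (ts ! i)"] IH nth_mem[OF t(2)] by blast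
    moreover from this have "diamond_depth w \<le> Max (insert 0 (diamond_depth ` set ts))"
      by (intro Max_ge) auto
    ultimately show ?thesis
      by (meson order_trans)
  qed
  then have "Max (insert 0 (diamond_depth ` set (ts[i := replace_at p u (ts ! i)]))) \<le> Max (insert 0 (diamond_depth ` set ts))"
    by (intro Max.boundedI) auto
  then show ?case
    using t by simp
qed simp

lemma diamond_depth_fill: "matches C t \<Longrightarrow> s \<in> aliens C t \<Longrightarrow> diamond_depth (h s) \<le> diamond_depth (fill DSym h C t)"
proof (induction rule: matches.induct)
  case (Fun Cs ts f)
  then obtain i where i: "i < length ts" "s \<in> aliens (Cs ! i) (ts ! i)"
    by auto
  have "diamond_depth (h s) \<le> diamond_depth (fill DSym h (Cs ! i) (ts ! i))"
    using i Fun.IH by auto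
  also have "\<dots> \<le> diamond_depth (fill DSym h (Fun (HSym f) Cs) (Fun f ts))"
    unfolding fill.simps by (rule diamond_depth_arg_le) (use i Fun.hyps in auto)
  finally show ?case .
qed auto

abbreviation dia_step :: "'f sig \<Rightarrow> ('f with_diamond, 'v) trm \<Rightarrow> ('f with_diamond, 'v) trm \<Rightarrow> bool" where
  "dia_step F \<equiv> rstep (diamond_sig F) (range diamond_rule)"

abbreviation ext_step :: "'f sig \<Rightarrow> ('f, 'v) trs \<Rightarrow>
    ('f with_diamond, 'v) trm \<Rightarrow> ('f with_diamond, 'v) trm \<Rightarrow> bool" where
  "ext_step F R \<equiv> rstep (diamond_sig F) (diamond_trs R \<union> range diamond_rule)"

lemma diamond_sig_simps [simp]:
  "(Diamond, n) \<in> diamond_sig F \<longleftrightarrow> n = 1" "(DSym f, n) \<in> diamond_sig F \<longleftrightarrow> (f, n) \<in> F"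
  by (force simp: diamond_sig_def)+

lemma dia_step_root:
  assumes "m \<in> terms (diamond_sig F)"
  shows "dia_step F (Fun Diamond [m]) m"
proof -
  have "step_at [] (diamond_rule x) (Fun Diamond [m]) m" for x :: 'b
    by (auto simp: step_at_def diamond_rule_def intro!: exI[of _ "\<lambda>_. m"])
  then show ?thesis
    using assms by (auto simp: rstep_def)
qed

text \<open>The embedded rules of \<open>R\<close> contain no diamond and bring in no new variables,
  and a diamond rule only removes a diamond.\<close>

lemma diamond_depth_ext_step:
  assumes "is_trs F R" "ext_step F R m m'"
  shows "diamond_depth m' \<le> diamond_depth m"
proof -
  obtain \<rho> p where \<rho>: "\<rho> \<in> diamond_trs R \<union> range diamond_rule" and "step_at p \<rho> m m'"
    using assms(2) unfolding rstep_def by blast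
  then obtain \<sigma> where p: "p \<in> poss m"
    and m: "subt_at p m = subst \<sigma> (fst \<rho>)" "m' = replace_at p (subst \<sigma> (snd \<rho>)) m"
    unfolding step_at_def by blast
  have "diamond_depth (subst \<sigma> (snd \<rho>)) \<le> diamond_depth (subst \<sigma> (fst \<rho>))"
    using \<rho>
  proof (rule UnE)
    assume "\<rho> \<in> diamond_trs R"
    then obtain l r where lr: "(l, r) \<in> R" "\<rho> = (map_trm DSym id l, map_trm DSym id r)"
      by (auto simp: diamond_trs_def)
    then have "vars_of r \<subseteq> vars_of l"
      using assms(1) by (auto simp: is_trs_def)
    then have "diamond_depth (subst \<sigma> (map_trm DSym id r)) \<le> diamond_depth (subst \<sigma> (map_trm DSym id l))"
      using iffD1[OF diamond_depth_subst_le[of \<sigma> l] order_refl] by (intro diamond_depth_subst_le[THEN iffD2]) blast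
    then show ?thesis
      using lr by simp
  qed (auto simp: diamond_rule_def)
  then show ?thesis
    using diamond_depth_replace_at[OF p] m by simp
qed

lemma diamond_depth_ext_steps:
  assumes "is_trs F R" "(ext_step F R)\<^sup>*\<^sup>* m m'"
  shows "diamond_depth m' \<le> diamond_depth m"
  using assms(2) by induction (auto dest: diamond_depth_ext_step[OF assms(1)])

text \<open>Bounded duplication forbids certain infinite sequences of single steps, while induction
  needs well-foundedness of a composed relation. A descending chain of the latter is expanded into
  single steps.\<close>

lemma wf_relative:
  fixes r d :: "'a \<Rightarrow> 'a \<Rightarrow> bool"
  assumes no_chain: "\<And>g :: nat \<Rightarrow> 'a. (\<And>i. r (g i) (g (Suc i))) \<Longrightarrow> \<not> (\<exists>\<^sub>\<infinity>i. d (g i) (g (Suc i)))"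
    and d_r: "\<And>x y. d x y \<Longrightarrow> r x y"
  shows "wf {(y, x). (r\<^sup>*\<^sup>* OO d OO r\<^sup>*\<^sup>*) x y}"
proof (rule ccontr)
  assume "\<not> ?thesis"
  then obtain f where f: "\<And>i. (r\<^sup>*\<^sup>* OO d OO r\<^sup>*\<^sup>*) (f i) (f (Suc i))"
    by (auto simp: wf_iff_no_infinite_down_chain)
  \<comment> \<open>The counter \<open>n\<close> of remaining \<open>r\<close>-steps before a \<open>d\<close>-step makes dependent choice flatten the chain.\<close>
  define live where "live n x \<longleftrightarrow> (\<exists>y z i. (r ^^ n) x y \<and> d y z \<and> r\<^sup>*\<^sup>* z (f i))" for n x
  have live_ex: "\<exists>n. live n x" if "r\<^sup>*\<^sup>* x (f i)" for x i
  proof -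
    obtain y z where "r\<^sup>*\<^sup>* (f i) y" "d y z" "r\<^sup>*\<^sup>* z (f (Suc i))"
      using f[of i] by auto
    moreover from this that obtain n where "(r ^^ n) x y"
      by (meson rtranclp_imp_relpowp rtranclp_trans)
    ultimately show ?thesis
      unfolding live_def by blast
  qed
  \<comment> \<open>At counter 0 the \<open>d\<close>-step is due, and the next counter is left open
    here; \<open>live\<close> will restrict it.\<close>
  define nxt where "nxt q q' \<longleftrightarrow> (if snd q = 0 then d (fst q) (fst q')
      else r (fst q) (fst q') \<and> snd q = Suc (snd q'))" for q q' :: "'a \<times> nat"
  have step: "\<exists>q'. live (snd q') (fst q') \<and> nxt q q'" if l: "live (snd q) (fst q)" for q
  proof (cases "snd q")
    case 0
    then obtain z i where "d (fst q) z" "r\<^sup>*\<^sup>* z (f i)"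
      using l by (auto simp: live_def)
    moreover from this obtain n where "live n z"
      using live_ex by blast
    ultimately show ?thesis
      using 0 by (intro exI[of _ "(z, n)"]) (simp add: nxt_def)
  next
    case (Suc n)
    from l obtain y z i where "(r ^^ Suc n) (fst q) y" "d y z" "r\<^sup>*\<^sup>* z (f i)"
      unfolding live_def Suc by blast
    moreover from this obtain x where "r (fst q) x" "(r ^^ n) x y"
      by (meson relpowp_Suc_E2)
    ultimately have "live n x" "nxt q (x, n)"
      using Suc by (auto simp: live_def nxt_def)
    then show ?thesis
      by (intro exI[of _ "(x, n)"]) auto
  qed
  obtain n0 where "live n0 (f 0)"
    using live_ex by blast
  then have "\<exists>q. live (snd q) (fst q)"
    by (intro exI[of _ "(f 0, n0)"]) simp
  from dependent_nat_choice[of "\<lambda>_ q. live (snd q) (fst q)" "\<lambda>_. nxt", OF this step]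
  obtain g where g: "\<And>i. live (snd (g i)) (fst (g i))" "\<And>i. nxt (g i) (g (Suc i))"
    by blast
  \<comment> \<open>A positive counter falls by one at each step, so the value 0 recurs
    forever.\<close>
  have "\<exists>i\<ge>m. snd (g i) = 0" for m
  proof (induction "snd (g m)" arbitrary: m)
    case (Suc n)
    then have "n = snd (g (Suc m))"
      using g(2)[of m] by (auto simp: nxt_def split: if_splits)
    from Suc.hyps(1)[OF this] show ?case
      by (meson Suc_leD)
  qed auto
  moreover have "d (fst (g i)) (fst (g (Suc i)))" if "snd (g i) = 0" for i
    using g(2)[of i] that by (simp add: nxt_def)
  ultimately have "\<exists>i\<ge>m. d (fst (g i)) (fst (g (Suc i)))" for m
    by blast
  then have "\<exists>\<^sub>\<infinity>i. d (fst (g i)) (fst (g (Suc i)))"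
    by (simp add: INFM_nat_le)
  moreover have "r (fst (g i)) (fst (g (Suc i)))" for i
    using g(2)[of i] d_r by (auto simp: nxt_def split: if_splits)
  ultimately show False
    using no_chain[of "\<lambda>i. fst (g i)"] by blast
qed

abbreviation desc :: "'f sig \<Rightarrow> ('f, 'v) trs \<Rightarrow>
    ('f with_diamond, 'v) trm \<Rightarrow> ('f with_diamond, 'v) trm \<Rightarrow> bool" where
  "desc F R \<equiv> (ext_step F R)\<^sup>*\<^sup>* OO dia_step F OO (ext_step F R)\<^sup>*\<^sup>*"

lemma dia_steps_ext: "(dia_step F)\<^sup>*\<^sup>* m m' \<Longrightarrow> (ext_step F R)\<^sup>*\<^sup>* m m'"
  by (erule rsteps_mono) simp

lemma wf_desc:
  assumes "bounded_duplicating F R"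
  shows "wf {(m', m). desc F R m m'}"
proof (rule wf_relative)
  show "ext_step F R x y" if "dia_step F x y" for x y
    using that by (rule rstep_mono) simp
next
  fix g
  assume "ext_step F R (g i) (g (Suc i))" for i
  then have "\<forall>i. ext_step F R (g i) (g (Suc i))"
    by blast
  then show "\<not> (\<exists>\<^sub>\<infinity>i. dia_step F (g i) (g (Suc i)))"
    using assms unfolding bounded_duplicating_def by blast
qed

text \<open>A term therefore has finitely many tops, and merging them one by one ends in a greatest
  one.\<close>

lemma finite_hole_le: "finite {C. hole_le C D}"
proof (induction D)
  case (Var x)
  have "{C. hole_le C (Var x :: ('a, 'b) ctxt)} \<subseteq> {hole, Var x}"
    by (auto simp: hole_le_Var_right)
  then show ?case by (rule finite_subset) simp
next
  case (Fun g Ds)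
  have "C \<in> insert hole (Fun g ` {Cs. set Cs \<subseteq> (\<Union>D\<in>set Ds. {C. hole_le C D}) \<and> length Cs = length Ds})"
    if "hole_le C (Fun g Ds)" for C
    using that
  proof cases
    case (Fun Cs f)
    then have "set Cs \<subseteq> (\<Union>D\<in>set Ds. {C. hole_le C D})"
      using nth_mem by (fastforce simp: in_set_conv_nth)
    then show ?thesis
      using Fun by auto
  qed auto
  then have "{C. hole_le C (Fun g Ds)} \<subseteq>
    insert hole (Fun g ` {Cs. set Cs \<subseteq> (\<Union>D\<in>set Ds. {C. hole_le C D}) \<and> length Cs = length Ds})"
    by blast
  then show ?case
    by (rule finite_subset) (use Fun in \<open>auto intro!: finite_lists_length_eq\<close>)
qed

section \<open>Fusion of layers\<close>

locale layered_trs =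
  fixes F :: "'f sig" and LL :: "('f, 'v) ctxt set" and R :: "('f, 'v) trs"
  assumes layers: "layer_system F LL"
    and trs: "is_trs F R"
    and layered: "weakly_layered F LL R"
begin

section \<open>Greatest tops\<close>

lemma LL_ctxts: "L \<in> LL \<Longrightarrow> L \<in> ctxts F"
  using layers unfolding layer_system_def by blast

lemma is_top_iff: "t \<in> terms F \<Longrightarrow> is_top F LL L (ctxt_of t) \<longleftrightarrow> L \<in> LL \<and> matches L t"
  by (auto simp: is_top_def ctxt_le_iff matches_iff ctxt_of_terms)

lemma LL_Var_hole: "C \<in> ctxts F \<Longrightarrow> p \<in> poss C \<Longrightarrow> replace_at p hole C \<in> LL \<Longrightarrow> replace_at p (Var x) C \<in> LL"
  using layers unfolding layer_system_def by blast

lemma LL_lub: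
  "L \<in> LL \<Longrightarrow> N \<in> LL \<Longrightarrow> p \<in> fun_poss L \<Longrightarrow> is_ctxt_lub F (subt_at p L) N U \<Longrightarrow>
    replace_at p U L \<in> LL"
  using layers unfolding layer_system_def by blast

text \<open>(L3) applies because the subterm of \<open>t\<close> at \<open>p\<close> is an upper
  bound of \<open>L\<close> and of the part of \<open>M\<close> at \<open>p\<close>. For the same
  reason the enlarged layer is still a top of \<open>t\<close>.\<close>

lemma LL_merge:
  assumes "M \<in> LL" "matches M t" "t \<in> terms F" "p \<in> fun_poss M" "L \<in> LL" "matches L (subt_at p t)"
  obtains M' where "M' \<in> LL" "matches M' t" "hole_le M M'" "hole_le L (subt_at p M')"
proof -
  have p: "p \<in> poss M"
    using assms(4) by (auto simp: fun_poss_def)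
  have pt: "p \<in> poss t" and at: "matches (subt_at p M) (subt_at p t)"
    using matches_at[OF assms(2) p] by blast+
  let ?U = "merge (subt_at p M) L"
  have lub: "hole_le (subt_at p M) ?U \<and> hole_le L ?U \<and> hole_le ?U (ctxt_of (subt_at p t))"
    using at assms(6) unfolding matches_iff by (rule merge_lub)
  have "is_ctxt_lub F (subt_at p M) L ?U"
    using at assms(6) ctxt_of_terms[OF subt_at_terms[OF pt assms(3)]]
    unfolding matches_iff by (rule is_ctxt_lub_merge)
  then have "replace_at p ?U M \<in> LL"
    by (rule LL_lub[OF assms(1,5,4)])
  moreover have "matches (replace_at p ?U M) t"
    using matches_replace_at[OF assms(2) p, of ?U "subt_at p t"] lub replace_at_subt_at[OF pt]
    by (simp add: matches_iff)
  moreover have "hole_le M (replace_at p ?U M)"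
    using hole_le_replace_at[OF hole_le_refl[OF LL_ctxts[OF assms(1)]] p] lub replace_at_subt_at[OF p] by metis
  moreover have "hole_le L (subt_at p (replace_at p ?U M))"
    using lub subt_at_replace_at[OF p] by simp
  ultimately show thesis
    by (rule that)
qed

text \<open>(L1) supplies a top other than the hole, and (L3) at the root merges the finitely many
  tops into one.\<close>

lemma ex_greatest_top:
  assumes t: "t \<in> terms F"
  shows "\<exists>M. M \<in> LL \<and> matches M t \<and> M \<noteq> hole \<and> (\<forall>L\<in>LL. matches L t \<longrightarrow> hole_le L M)"
proof -
  have "\<exists>L. is_top F LL L (ctxt_of t) \<and> L \<noteq> hole"
    using layers t unfolding layer_system_def by blast
  then obtain L0 where L0: "L0 \<in> LL" "matches L0 t" "L0 \<noteq> hole"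
    using is_top_iff[OF t] by auto
  have fin: "finite {L \<in> LL. matches L t}"
    by (rule finite_subset[OF _ finite_hole_le[of "ctxt_of t"]]) (auto simp: matches_iff)
  have bound: "\<exists>M. M \<in> LL \<and> matches M t \<and> (\<forall>L\<in>B. hole_le L M)"
    if "finite B" "B \<subseteq> {L \<in> LL. matches L t}" for B
    using that
  proof (induction rule: finite_induct)
    case empty
    then show ?case using L0 by auto
  next
    case (insert L B)
    then obtain M where M: "M \<in> LL" "matches M t" "\<forall>L\<in>B. hole_le L M"
      by auto
    \<comment> \<open>(L3) needs a function symbol at the root of \<open>M\<close>, so the hole and
      variables are treated apart.\<close>
    from M(2) show ?case
    proof cases
      case hole
      then show ?thesis
        using insert.prems M by (intro exI[of _ L]) (auto intro: hole_le_refl LL_ctxts simp: hole_le_hole_right hole_le.hole)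
    next
      case (Var x)
      then have "hole_le L M"
        using insert.prems by (auto simp: matches_iff)
      then show ?thesis
        using M by auto
    next
      case (Fun Cs ts f)
      then have "[] \<in> fun_poss M"
        by (auto simp: fun_poss_def)
      then obtain M' where M': "M' \<in> LL" "matches M' t" "hole_le M M'" "hole_le L M'"
        using LL_merge[OF M(1,2) t, of "[]" L] insert.prems by auto
      then have "\<forall>L\<in>insert L B. hole_le L M'"
        using M(3) hole_le_trans by blast
      then show ?thesis
        using M' by blast
    qed
  qed
  obtain M where M: "M \<in> LL" "matches M t" "\<forall>L\<in>LL. matches L t \<longrightarrow> hole_le L M"
    using bound[OF fin order_refl] by auto
  then have "M \<noteq> hole"
    using L0 by (auto simp: hole_le_hole_right)
  then show ?thesis
    using M by blast
qed

definition max_top :: "('f, 'v) trm \<Rightarrow> ('f, 'v) ctxt" where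
  "max_top t = (SOME M. M \<in> LL \<and> matches M t \<and> M \<noteq> hole \<and> (\<forall>L\<in>LL. matches L t \<longrightarrow> hole_le L M))"

lemma
  assumes "t \<in> terms F"
  shows max_top_LL: "max_top t \<in> LL" and matches_max_top: "matches (max_top t) t" and max_top_not_hole: "max_top t \<noteq> hole"
    and max_top_greatest: "L \<in> LL \<Longrightarrow> matches L t \<Longrightarrow> hole_le L (max_top t)"
  using someI_ex[OF ex_greatest_top[OF assms]] unfolding max_top_def by auto

lemma max_top_is_max_top:
  assumes "t \<in> terms F"
  shows "is_max_top F LL (max_top t) (ctxt_of t)"
  using assms unfolding is_max_top_def is_top_iff[OF assms] ctxt_le_iff
  by (auto intro: max_top_LL matches_max_top max_top_greatest hole_le_antisym)

text \<open>The property of \<open>N = max_top t\<close> that is inherited by corresponding subterms of \<open>N\<close> and \<open>t\<close>;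
  \<open>N\<close> itself need not be a layer.\<close>

definition saturated :: "('f, 'v) ctxt \<Rightarrow> ('f, 'v) trm \<Rightarrow> bool" where
  "saturated N s \<longleftrightarrow> (\<forall>p\<in>fun_poss N. \<forall>L\<in>LL. matches L (subt_at p s) \<longrightarrow> hole_le L (subt_at p N))"

text \<open>Otherwise (L3) would merge \<open>L\<close> into the max-top at \<open>p\<close> and
  give a larger top of \<open>t\<close>.\<close>

lemma saturated_max_top:
  assumes t: "t \<in> terms F"
  shows "saturated (max_top t) t"
  unfolding saturated_def
proof (intro ballI impI)
  fix p L
  assume p: "p \<in> fun_poss (max_top t)" and L: "L \<in> LL" "matches L (subt_at p t)"
  obtain M' where M': "M' \<in> LL" "matches M' t" "hole_le (max_top t) M'" "hole_le L (subt_at p M')"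
    by (rule LL_merge[OF max_top_LL[OF t] matches_max_top[OF t] t p L])
  then have "M' = max_top t"
    using max_top_greatest[OF t] by (auto intro: hole_le_antisym)
  then show "hole_le L (subt_at p (max_top t))"
    using M' by simp
qed

lemma saturated_arg: "saturated (Fun g Ns) (Fun f ss) \<Longrightarrow> i < length Ns \<Longrightarrow> saturated (Ns ! i) (ss ! i)"
  unfolding saturated_def
proof (intro ballI impI)
  fix p L
  assume *: "\<forall>p\<in>fun_poss (Fun g Ns). \<forall>L\<in>LL. matches L (subt_at p (Fun f ss)) \<longrightarrow> hole_le L (subt_at p (Fun g Ns))"
    "i < length Ns" "p \<in> fun_poss (Ns ! i)" "L \<in> LL" "matches L (subt_at p (ss ! i))"
  then have "i # p \<in> fun_poss (Fun g Ns)"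
    by (auto simp: fun_poss_def)
  from *(1)[rule_format, OF this *(4)] *(5) show "hole_le L (subt_at p (Ns ! i))"
    by simp
qed

text \<open>Only for terms over \<open>F\<close> is the max-top known to differ from the hole. Other
  terms are merely embedded, which secures termination.\<close>

function mark :: "('f, 'v) trm \<Rightarrow> ('f with_diamond, 'v) trm" where
  "mark t = (if t \<in> terms F then fill DSym (\<lambda>s. Fun Diamond [mark s]) (max_top t) t
    else map_trm DSym id t)"
  by auto
termination
  by (relation "measure size") (auto dest: aliens_size[OF matches_max_top] max_top_not_hole)

declare mark.simps [simp del]

abbreviation boxed :: "('f, 'v) trm \<Rightarrow> ('f with_diamond, 'v) trm" where
  "boxed s \<equiv> Fun Diamond [mark s]"

lemma mark_terms: "t \<in> terms F \<Longrightarrow> mark t \<in> terms (diamond_sig F)"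
proof (induction t rule: measure_induct_rule[of size])
  case (less t)
  have "boxed s \<in> terms (diamond_sig F)" if "s \<in> aliens (max_top t) t" for s
    using that less.IH[of s] aliens_size[OF matches_max_top[OF less.prems] that] max_top_not_hole[OF less.prems]
      aliens_terms[OF matches_max_top[OF less.prems] less.prems] by auto
  then show ?case
    using less.prems by (subst mark.simps) (auto intro!: fill_terms matches_max_top)
qed

lemma fill_boxed_terms:
  "matches C t \<Longrightarrow> t \<in> terms F \<Longrightarrow> fill DSym boxed C t \<in> terms (diamond_sig F)"
  by (rule fill_terms) (auto intro: mark_terms dest: aliens_terms)

lemma mark_eq: "t \<in> terms F \<Longrightarrow> mark t = fill DSym boxed (max_top t) t"
  by (subst mark.simps) simp

text \<open>Enlarging the layer from \<open>L\<close> to \<open>N\<close> fuses aliens with it at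
  the price of diamonds. Where \<open>L\<close> has a hole and \<open>N\<close> does not, the
  diamond on the alien is removed; saturation puts the max-top of the alien below \<open>N\<close>,
  so the process continues from that max-top. Elsewhere it descends into the arguments.\<close>

lemma fuse:
  "saturated N s \<Longrightarrow> matches N s \<Longrightarrow> s \<in> terms F \<Longrightarrow> hole_le L N \<Longrightarrow>
    (dia_step F)\<^sup>*\<^sup>* (fill DSym boxed L s) (fill DSym boxed N s)"
proof (induction s arbitrary: L N)
  case (Var x)
  have "max_top (Var x) = Var x"
    using matches_max_top[of "Var x"] max_top_not_hole[of "Var x"] by (auto elim: matches.cases)
  then have "mark (Var x) = Var x"
    by (simp add: mark_eq)
  then have "dia_step F (boxed (Var x)) (Var x)"
    using dia_step_root[of "Var x" F] by simp
  with Var.prems(2,4) show ?case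
    by (auto elim!: matches.cases[of N] simp: hole_le_hole_right hole_le_Var_right)
next
  case (Fun f ss)
  from Fun.prems(2) show ?case
  proof cases
    case hole
    then show ?thesis using Fun.prems by (auto simp: hole_le_hole_right)
  next
    case (Fun Ns)
    \<comment> \<open>Stated for any \<open>Ls\<close>, for use both with \<open>L\<close> itself
      and with the max-top of the alien.\<close>
    have args: "(dia_step F)\<^sup>*\<^sup>* (fill DSym boxed (Fun (HSym f) Ls) (Fun f ss)) (fill DSym boxed N (Fun f ss))"
      if "hole_le (Fun (HSym f) Ls) N" for Ls
    proof -
      have Ls: "length Ls = length ss" "\<And>i. i < length ss \<Longrightarrow> hole_le (Ls ! i) (Ns ! i)"
        using that Fun by (auto simp: hole_le_Fun_Fun)
      have "(dia_step F)\<^sup>*\<^sup>* (fill DSym boxed (Ls ! i) (ss ! i)) (fill DSym boxed (Ns ! i) (ss ! i))"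
        if "i < length ss" for i
        using Fun.IH[of "ss ! i" "Ns ! i" "Ls ! i"] that Fun Fun.prems saturated_arg Ls by auto
      moreover have "fill DSym boxed (Fun (HSym f) Ls) (Fun f ss) \<in> terms (diamond_sig F)"
        using that Fun.prems hole_le_matches by (intro fill_boxed_terms) auto
      ultimately show ?thesis
        using Fun Ls by (auto intro!: rsteps_args)
    qed
    show ?thesis
    proof (cases "L = hole")
      case True
      have "[] \<in> fun_poss N"
        using Fun by (auto simp: fun_poss_def)
      then have "hole_le (max_top (Fun f ss)) N"
        using Fun.prems(1) max_top_LL[OF Fun.prems(3)] matches_max_top[OF Fun.prems(3)]
        by (fastforce simp: saturated_def)
      moreover from this obtain Ls where "max_top (Fun f ss) = Fun (HSym f) Ls"
        using max_top_not_hole[OF Fun.prems(3)] Fun by (auto simp: hole_le_Fun_right)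
      ultimately have "(dia_step F)\<^sup>*\<^sup>* (mark (Fun f ss)) (fill DSym boxed N (Fun f ss))"
        using args mark_eq[OF Fun.prems(3)] by metis
      then show ?thesis
        using True dia_step_root[OF mark_terms[OF Fun.prems(3)]]
        by (simp add: converse_rtranclp_into_rtranclp)
    next
      case False
      then obtain Ls where "L = Fun (HSym f) Ls"
        using Fun Fun.prems(4) by (auto simp: hole_le_Fun_right)
      then show ?thesis
        using args Fun.prems(4) by blast
    qed
  qed
qed

text \<open>A hole is filled by a term with a diamond at the root, any other matching context by one
  without. Hence a proper enlargement in \<open>fuse\<close> takes at least one diamond
  step.\<close>

lemma fill_boxed_inj:
  "hole_le L N \<Longrightarrow> matches N s \<Longrightarrow> fill DSym boxed L s = fill DSym boxed N s \<Longrightarrow> L = N"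
proof (induction arbitrary: s rule: hole_le.induct)
  case (hole D)
  from hole.prems show ?case by cases auto
next
  case (Fun Cs Ds f)
  from Fun.prems(1) obtain ts where ts: "s = Fun f ts" "length Ds = length ts"
      "\<And>i. i < length ts \<Longrightarrow> matches (Ds ! i) (ts ! i)"
    by (auto simp: matches_Fun_left)
  have "Cs ! i = Ds ! i" if "i < length Ds" for i
  proof (rule Fun.IH[OF that])
    show "fill DSym boxed (Cs ! i) (ts ! i) = fill DSym boxed (Ds ! i) (ts ! i)"
      using Fun.prems(2) Fun.hyps ts that by auto
  qed (use ts that in auto)
  with Fun.hyps(1) have "Cs = Ds"
    by (auto intro: nth_equalityI)
  then show ?case by simp
qed auto

lemma fuse_max_top:
  assumes "t \<in> terms F" "L \<in> LL" "matches L t"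
  shows "(dia_step F)\<^sup>*\<^sup>* (fill DSym boxed L t) (mark t)"
    and "L \<noteq> max_top t \<Longrightarrow> (dia_step F)\<^sup>+\<^sup>+ (fill DSym boxed L t) (mark t)"
proof -
  have hole_le: "hole_le L (max_top t)"
    using max_top_greatest assms by blast
  show steps: "(dia_step F)\<^sup>*\<^sup>* (fill DSym boxed L t) (mark t)"
    using fuse[OF saturated_max_top matches_max_top assms(1) hole_le] assms(1) by (simp add: mark_eq)
  show "(dia_step F)\<^sup>+\<^sup>+ (fill DSym boxed L t) (mark t)" if "L \<noteq> max_top t"
    using steps fill_boxed_inj[OF hole_le matches_max_top] that assms(1) by (auto simp: mark_eq dest: rtranclpD)
qed

text \<open>The last conjunct says that replacing aliens by a function that does not distinguish an alien from
  its one-step reduct turns the step \<open>t \<rightarrow> t'\<close> into a (possibly empty) reduction.\<close>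

definition sim :: "('f, 'v) trm \<Rightarrow> ('f, 'v) ctxt \<Rightarrow> ('f, 'v) trm \<Rightarrow> bool" where
  "sim t L t' \<longleftrightarrow> L \<in> LL \<and> matches L t' \<and> (ext_step F R)\<^sup>*\<^sup>* (mark t) (fill DSym boxed L t') \<and>
    (\<forall>h. (\<forall>s \<in> aliens (max_top t) t. h s \<in> terms F) \<longrightarrow>
      (\<forall>s \<in> aliens (max_top t) t. \<forall>s' \<in> aliens L t'. rstep F R s s' \<longrightarrow> h s = h s') \<longrightarrow>
      (rstep F R)\<^sup>*\<^sup>* (fill id h (max_top t) t) (fill id h L t'))"

text \<open>The assumption \<open>IH\<close> is \<open>mark_rstep\<close> for aliens, which in turn
  is proved from this lemma by induction on the size.\<close>

lemma ex_sim_aux: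
  assumes step: "rstep F R t t'"
    and IH: "\<And>s s'. s \<in> aliens (max_top t) t \<Longrightarrow> rstep F R s s' \<Longrightarrow> (ext_step F R)\<^sup>*\<^sup>* (mark s) (mark s')"
  shows "\<exists>L. sim t L t'"
proof -
  have t: "t \<in> terms F" and t': "t' \<in> terms F"
    using step by (auto simp: rstep_def)
  obtain l r p where lr: "(l, r) \<in> R" and p: "step_at p (l, r) t t'"
    using step by (auto simp: rstep_def)
  have vars: "vars_of r \<subseteq> vars_of l" and l: "l \<notin> range Var"
    using trs lr by (auto simp: is_trs_def)
  have pt: "p \<in> poss t"
    using p by (auto simp: step_at_def)
  note M = max_top_LL[OF t] matches_max_top[OF t]
  from M(2) pt show ?thesis
  proof (cases rule: poss_cases)
    \<comment> \<open>The redex lies in the layer: (W) rewrites the max-top itself to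
      \<open>L\<close>.\<close>
    case 1
    then obtain L where L: "L \<in> LL" "step_at p (ctxt_rule (l, r)) (max_top t) L"
      using layered lr t t' max_top_is_max_top[OF t] p unfolding weakly_layered_def by blast
    note fill = step_at_fill[OF p L(2) M(2) vars]
    have "fill DSym boxed L t' \<in> terms (diamond_sig F)"
      using fill(1) t' by (rule fill_boxed_terms)
    then have "ext_step F R (mark t) (fill DSym boxed L t')"
      using fill(3)[of DSym boxed] lr mark_terms[OF t] unfolding rstep_def mark_eq[OF t]
      by (force simp: diamond_trs_def)
    moreover have "rstep F R (fill id h (max_top t) t) (fill id h L t')"
      if h: "\<forall>s \<in> aliens (max_top t) t. h s \<in> terms F" for h
    proof -
      have "fill id h (max_top t) t \<in> terms F"
        by (rule fill_terms[OF M(2) t]) (use h in auto)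
      moreover have "fill id h L t' \<in> terms F"
        by (rule fill_terms[OF fill(1) t']) (use h fill(2) in auto)
      ultimately show ?thesis
        using fill(3)[of id h] lr by (auto simp: rstep_def trm.map_id)
    qed
    ultimately show ?thesis
      unfolding sim_def using L(1) fill(1) by (intro exI[of _ L]) auto
  next
    \<comment> \<open>A redex that is a variable would force \<open>l\<close> to be one.\<close>
    case 2
    then show ?thesis
      using p l by (cases l) (auto simp: step_at_def)
  next
    \<comment> \<open>The redex lies in the alien at \<open>q\<close>. The layer stays a top of
      \<open>t'\<close>, though perhaps not the greatest one, and \<open>h\<close> does not notice
      the change of the alien.\<close>
    case (3 q p')
    let ?s = "subt_at q t"
    obtain \<sigma> where \<sigma>: "subt_at p' ?s = subst \<sigma> l" "t' = replace_at p (subst \<sigma> r) t"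
      using p 3 matches_at[OF M(2) 3(2)] unfolding step_at_def by (auto simp: subt_at_append)
    define s' where "s' = replace_at p' (subst \<sigma> r) ?s"
    have at: "q \<in> poss t" "?s \<in> aliens (max_top t) t"
      using matches_at[OF M(2) 3(2)] 3(3) by auto
    note fill_at = fill_at[OF M(2) 3(2), unfolded 3(3), simplified]
    have t'_eq: "t' = replace_at q s' t"
      using \<sigma>(2) 3 at(1) by (simp add: s'_def replace_at_append)
    have s: "?s \<in> terms F" and s': "s' \<in> terms F"
      using at(1) t t' subt_at_terms[of q t'] by (auto simp: t'_eq intro: subt_at_terms)
    have "step_at p' (l, r) ?s s'"
      using 3(4) \<sigma>(1) by (auto simp: step_at_def s'_def)
    then have ss': "rstep F R ?s s'"
      using lr s s' by (auto simp: rstep_def)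
    have M': "replace_at q hole (max_top t) = max_top t"
      using replace_at_subt_at[OF 3(2)] 3(3) by simp
    note rep = matches_replace_at[OF M(2) 3(2) matches.hole[of s'], unfolded M' t'_eq[symmetric], THEN conjunct1]
      fill_replace_at[OF M(2) 3(2) matches.hole[of s'], unfolded M' t'_eq[symmetric] fill.simps]
    have s'_alien: "s' \<in> aliens (max_top t) t'"
      using matches_at[OF rep(1) 3(2)] 3(3) at(1) by (auto simp: t'_eq)
    have "(ext_step F R)\<^sup>*\<^sup>* (boxed ?s) (boxed s')"
      using IH[OF at(2) ss'] mark_terms[OF s] rsteps_args[of "[mark ?s]" "[mark s']"] by auto
    from rsteps_replace_at[OF this mark_terms[OF t, unfolded mark_eq[OF t]], of q]
    have "(ext_step F R)\<^sup>*\<^sup>* (mark t) (fill DSym boxed (max_top t) t')"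
      using fill_at[of DSym boxed] replace_at_subt_at[of q "fill DSym boxed (max_top t) t"]
      by (simp add: rep(2) mark_eq[OF t])
    moreover have "fill id h (max_top t) t' = fill id h (max_top t) t"
      if "\<forall>s\<in>aliens (max_top t) t. \<forall>s'\<in>aliens (max_top t) t'. rstep F R s s' \<longrightarrow> h s = h s'" for h :: "('f, 'v) trm \<Rightarrow> ('f, 'v) trm"
    proof -
      have "h s' = h ?s"
        using that at(2) s'_alien ss' by auto
      then show ?thesis
        using fill_at[of id h] replace_at_subt_at[of q "fill id h (max_top t) t"] by (simp add: rep(2))
    qed
    ultimately show ?thesis
      unfolding sim_def using M(1) rep(1) by (intro exI[of _ "max_top t"]) auto
  qed
qed

text \<open>The simulation ends in \<open>t'\<close> filled along a top \<open>L\<close>; the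
  diamond steps of \<open>fuse_max_top\<close> then lead to \<open>mark t'\<close>.\<close>

lemma mark_rstep: "rstep F R t t' \<Longrightarrow> (ext_step F R)\<^sup>*\<^sup>* (mark t) (mark t')"
proof (induction t arbitrary: t' rule: measure_induct_rule[of size])
  case (less t)
  have t: "t \<in> terms F" "t' \<in> terms F"
    using less.prems by (auto simp: rstep_def)
  have "\<exists>L. sim t L t'"
    by (rule ex_sim_aux[OF less.prems], rule less.IH)
      (use aliens_size[OF matches_max_top[OF t(1)]] max_top_not_hole[OF t(1)] in auto)
  then obtain L where "sim t L t'" ..
  then show ?case
    using dia_steps_ext[OF fuse_max_top(1)[OF t(2), of L]] unfolding sim_def
    by (meson rtranclp_trans)
qed

text \<open>If \<open>L\<close> is not the max-top of \<open>t'\<close>, the fusion contributes a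
  genuine diamond step after the simulated one.\<close>

lemma ex_sim:
  assumes "rstep F R t t'"
  obtains L where "sim t L t'" "L = max_top t' \<or> desc F R (mark t) (mark t')"
proof -
  obtain L where L: "sim t L t'"
    using ex_sim_aux[OF assms mark_rstep] by blast
  have t': "t' \<in> terms F"
    using assms by (auto simp: rstep_def)
  have "desc F R (mark t) (mark t')" if "L \<noteq> max_top t'"
  proof -
    have "(dia_step F)\<^sup>+\<^sup>+ (fill DSym boxed L t') (mark t')"
      using fuse_max_top(2)[OF t' _ _ that] L by (auto simp: sim_def)
    then obtain m where "dia_step F (fill DSym boxed L t') m" "(dia_step F)\<^sup>*\<^sup>* m (mark t')"
      by (auto dest: tranclpD)
    then show ?thesis
      using L dia_steps_ext unfolding sim_def by blast
  qed
  then show thesis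
    using that L by blast
qed

end

section \<open>Confluence\<close>

lemma confluent_common_reduct:
  assumes "finite S"
    and confl: "\<And>x y z. x \<in> D \<Longrightarrow> r\<^sup>*\<^sup>* x y \<Longrightarrow> r\<^sup>*\<^sup>* x z \<Longrightarrow> \<exists>u. r\<^sup>*\<^sup>* y u \<and> r\<^sup>*\<^sup>* z u"
    and "S \<subseteq> D" "s \<in> D" "\<And>x. x \<in> S \<Longrightarrow> \<exists>z. r\<^sup>*\<^sup>* s z \<and> r\<^sup>*\<^sup>* x z"
  shows "\<exists>z. r\<^sup>*\<^sup>* s z \<and> (\<forall>x\<in>S. r\<^sup>*\<^sup>* x z)"
  using assms(1,3,5)
proof (induction rule: finite_induct)
  case (insert x S)
  obtain z where z: "r\<^sup>*\<^sup>* s z" "\<forall>x\<in>S. r\<^sup>*\<^sup>* x z"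
    using insert.IH insert.prems by blast
  obtain y where y: "r\<^sup>*\<^sup>* s y" "r\<^sup>*\<^sup>* x y"
    using insert.prems(2) by blast
  obtain u where u: "r\<^sup>*\<^sup>* z u" "r\<^sup>*\<^sup>* y u"
    using confl[OF assms(4) z(1) y(1)] by blast
  have "r\<^sup>*\<^sup>* v u" if "v \<in> insert x S" for v
    using that z(2) y(2) u by (auto intro: rtranclp_trans)
  then show ?case
    using z(1) u(1) by (blast intro: rtranclp_trans)
qed blast

text \<open>The choice of \<open>w s\<close> depends only on \<open>cls s\<close>, the members of
  \<open>S\<close> joinable with \<open>s\<close>. By confluence at \<open>s\<close> they all share
  a reduct, and a step from \<open>s\<close> does not change the class.\<close>

lemma ex_witness:
  assumes "finite S"
    and confl: "\<And>x y z. x \<in> D \<Longrightarrow> r\<^sup>*\<^sup>* x y \<Longrightarrow> r\<^sup>*\<^sup>* x z \<Longrightarrow> \<exists>u. r\<^sup>*\<^sup>* y u \<and> r\<^sup>*\<^sup>* z u"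
    and S: "S \<subseteq> D"
  shows "\<exists>w. (\<forall>s\<in>S. r\<^sup>*\<^sup>* s (w s)) \<and> (\<forall>s\<in>S. \<forall>s'\<in>S. r s s' \<longrightarrow> w s = w s')"
proof -
  define cls where "cls s = {x \<in> S. \<exists>z. r\<^sup>*\<^sup>* s z \<and> r\<^sup>*\<^sup>* x z}" for s
  define w where "w s = (SOME z. \<forall>x\<in>cls s. r\<^sup>*\<^sup>* x z)" for s
  have w: "\<forall>x\<in>cls s. r\<^sup>*\<^sup>* x (w s)" if "s \<in> S" for s
  proof -
    have "\<exists>z. r\<^sup>*\<^sup>* s z \<and> (\<forall>x\<in>cls s. r\<^sup>*\<^sup>* x z)"
      by (rule confluent_common_reduct[where D = D])
        (use assms(1) confl S that in \<open>auto simp: cls_def\<close>)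
    then have "\<exists>z. \<forall>x\<in>cls s. r\<^sup>*\<^sup>* x z"
      by blast
    then show ?thesis
      unfolding w_def by (rule someI_ex)
  qed
  have "cls s = cls s'" if "s \<in> S" "r s s'" for s s'
  proof -
    have "\<exists>z. r\<^sup>*\<^sup>* s' z \<and> r\<^sup>*\<^sup>* x z" if x: "r\<^sup>*\<^sup>* s y" "r\<^sup>*\<^sup>* x y" for x y
    proof -
      obtain u where "r\<^sup>*\<^sup>* s' u" "r\<^sup>*\<^sup>* y u"
        using confl[of s s' y] \<open>s \<in> S\<close> \<open>r s s'\<close> S x(1) by blast
      then show ?thesis
        using x(2) by (meson rtranclp_trans)
    qed
    moreover have "r\<^sup>*\<^sup>* s z" if "r\<^sup>*\<^sup>* s' z" for z
      using that \<open>r s s'\<close> by (rule converse_rtranclp_into_rtranclp[rotated])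
    ultimately show ?thesis
      unfolding cls_def by blast
  qed
  then have "w s = w s'" if "s \<in> S" "r s s'" for s s'
    using that by (simp add: w_def)
  moreover have "r\<^sup>*\<^sup>* s (w s)" if "s \<in> S" for s
    using w[OF that] that by (auto simp: cls_def)
  ultimately show ?thesis
    by blast
qed

lemma vars_of_rstep: "is_trs F R \<Longrightarrow> rstep F R s t \<Longrightarrow> vars_of t \<subseteq> vars_of s"
  unfolding rstep_def is_trs_def by (fastforce dest: vars_of_step_at)

section \<open>Reductions up to the first fusion\<close>

context layered_trs
begin

text \<open>A reduction from \<open>t\<close> whose steps are all fusion-free, except possibly the last one.\<close>

inductive layered_path :: "('f, 'v) trm \<Rightarrow> ('f, 'v) ctxt \<Rightarrow> ('f, 'v) trm \<Rightarrow> bool" for t where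
  start: "layered_path t (max_top t) t"
| step: "layered_path t (max_top u) u \<Longrightarrow> rstep F R u v \<Longrightarrow> sim u L v \<Longrightarrow> layered_path t L v"

lemma layered_path_invs:
  assumes "layered_path t L u" "t \<in> terms F"
  shows "u \<in> terms F \<and> L \<in> LL \<and> matches L u \<and> vars_of u \<subseteq> vars_of t \<and>
    (ext_step F R)\<^sup>*\<^sup>* (mark t) (fill DSym boxed L u)"
  using assms
proof (induction rule: layered_path.induct)
  case start
  then show ?case
    by (simp add: max_top_LL matches_max_top mark_eq)
next
  case (step u v L)
  then have "(ext_step F R)\<^sup>*\<^sup>* (mark t) (mark u)"
    by (simp add: mark_eq)
  moreover have "v \<in> terms F" "vars_of v \<subseteq> vars_of u"
    using step.hyps(2) vars_of_rstep[OF trs] by (auto simp: rstep_def)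
  ultimately show ?case
    using step unfolding sim_def by (meson rtranclp_trans subset_trans)
qed

text \<open>In the filled term each alien stands below a diamond, and the depth does not grow along
  the reduction.\<close>

lemma layered_path_alien:
  assumes "layered_path t L u" "t \<in> terms F" "s \<in> aliens L u"
  shows "s \<in> terms F \<and> diamond_depth (mark s) < diamond_depth (mark t)"
proof -
  note inv = layered_path_invs[OF assms(1,2)]
  have "diamond_depth (boxed s) \<le> diamond_depth (fill DSym boxed L u)"
    using inv assms(3) by (intro diamond_depth_fill) auto
  also have "\<dots> \<le> diamond_depth (mark t)"
    using inv diamond_depth_ext_steps[OF trs] by blast
  finally show ?thesis
    using inv aliens_terms assms(3) by fastforce
qed

text \<open>The set \<open>S\<close> gathers the aliens met along the path. A single
  \<open>h\<close> that respects the steps between them thus serves every step, and the simulations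
  compose.\<close>

lemma layered_path_sim:
  assumes "layered_path t L u" "t \<in> terms F"
  shows "\<exists>S. finite S \<and> aliens L u \<subseteq> S \<and> (\<forall>s\<in>S. s \<in> terms F \<and> diamond_depth (mark s) < diamond_depth (mark t)) \<and>
    (\<forall>h. (\<forall>s\<in>S. h s \<in> terms F) \<longrightarrow> (\<forall>s\<in>S. \<forall>s'\<in>S. rstep F R s s' \<longrightarrow> h s = h s') \<longrightarrow>
      (rstep F R)\<^sup>*\<^sup>* (fill id h (max_top t) t) (fill id h L u))"
  using assms
proof (induction rule: layered_path.induct)
  case start
  then show ?case
    using layered_path_alien[OF layered_path.start] finite_aliens
    by (intro exI[of _ "aliens (max_top t) t"]) auto
next
  case (step u v L)
  then obtain S where S: "finite S" "aliens (max_top u) u \<subseteq> S" "\<forall>s\<in>S. s \<in> terms F \<and> diamond_depth (mark s) < diamond_depth (mark t)"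
    "\<And>h. (\<forall>s\<in>S. h s \<in> terms F) \<Longrightarrow> (\<forall>s\<in>S. \<forall>s'\<in>S. rstep F R s s' \<longrightarrow> h s = h s') \<Longrightarrow>
      (rstep F R)\<^sup>*\<^sup>* (fill id h (max_top t) t) (fill id h (max_top u) u)"
    by metis
  let ?S = "S \<union> aliens L v"
  have "(rstep F R)\<^sup>*\<^sup>* (fill id h (max_top t) t) (fill id h L v)"
    if h: "\<forall>s\<in>?S. h s \<in> terms F" "\<forall>s\<in>?S. \<forall>s'\<in>?S. rstep F R s s' \<longrightarrow> h s = h s'" for h
  proof -
    have "(rstep F R)\<^sup>*\<^sup>* (fill id h (max_top t) t) (fill id h (max_top u) u)"
      by (rule S(4)) (use h in auto)
    moreover have "(rstep F R)\<^sup>*\<^sup>* (fill id h (max_top u) u) (fill id h L v)"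
    proof -
      have "\<forall>s\<in>aliens (max_top u) u. h s \<in> terms F"
        "\<forall>s\<in>aliens (max_top u) u. \<forall>s'\<in>aliens L v. rstep F R s s' \<longrightarrow> h s = h s'"
        using h S(2) by blast+
      then show ?thesis
        using step.hyps(3) unfolding sim_def by blast
    qed
    ultimately show ?thesis
      by (rule rtranclp_trans)
  qed
  moreover have "\<forall>s\<in>?S. s \<in> terms F \<and> diamond_depth (mark s) < diamond_depth (mark t)"
    using S(3) layered_path_alien[OF layered_path.step[OF step.hyps] step.prems] by blast
  moreover have "finite ?S"
    using S(1) finite_aliens by simp
  ultimately show ?case
    by (intro exI[of _ ?S] conjI allI impI) blast+
qed

text \<open>Cuts the reduction right after its first fusion. In the case without fusion,
  \<open>L = max_top u\<close> is recorded so that the path can be prolonged.\<close>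

lemma layered_path_decompose:
  assumes "(rstep F R)\<^sup>*\<^sup>* t u" "t \<in> terms F"
  shows "\<exists>L v. layered_path t L v \<and> (rstep F R)\<^sup>*\<^sup>* v u \<and>
    (v = u \<and> L = max_top u \<or> desc F R (mark t) (mark v))"
  using assms
proof (induction rule: rtranclp_induct)
  case base
  then show ?case
    using layered_path.start by blast
next
  case (step u u')
  then obtain L v where v: "layered_path t L v" "(rstep F R)\<^sup>*\<^sup>* v u"
      "v = u \<and> L = max_top u \<or> desc F R (mark t) (mark v)"
    by blast
  from v(3) show ?case
  proof
    assume *: "v = u \<and> L = max_top u"
    obtain L' where L': "sim u L' u'" "L' = max_top u' \<or> desc F R (mark u) (mark u')"
      using ex_sim[OF step.hyps(2)] .
    have "layered_path t L' u'"
      using v(1) * step.hyps(2) L'(1) layered_path.step by blast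
    moreover have "(ext_step F R)\<^sup>*\<^sup>* (mark t) (mark u)"
      using layered_path_invs[OF v(1) step.prems] * by (simp add: mark_eq)
    then have "desc F R (mark u) (mark u') \<Longrightarrow> desc F R (mark t) (mark u')"
      by (blast intro: rtranclp_trans)
    ultimately show ?thesis
      using L'(2) by blast
  next
    assume "desc F R (mark t) (mark v)"
    then show ?thesis
      using v(1,2) step.hyps(2) by (meson rtranclp.rtrancl_into_rtrancl)
  qed
qed

text \<open>(L2) exchanges a single hole inside a layer. Quantifying over all surrounding contexts
  \<open>E\<close> makes the relation transitive and compatible with arguments, so that many holes
  can be exchanged in turn.\<close>

definition exchangeable :: "('f, 'v) ctxt \<Rightarrow> ('f, 'v) ctxt \<Rightarrow> bool" where
  "exchangeable C D \<longleftrightarrow> C \<in> ctxts F \<and> D \<in> ctxts F \<and>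
    (\<forall>E\<in>ctxts F. \<forall>p\<in>poss E. replace_at p C E \<in> LL \<longrightarrow> replace_at p D E \<in> LL)"

lemma exchangeable_args:
  assumes "list_all2 exchangeable Cs Ds" "Fun g (Bs @ Cs) \<in> ctxts F"
  shows "exchangeable (Fun g (Bs @ Cs)) (Fun g (Bs @ Ds))"
  using assms
proof (induction arbitrary: Bs rule: list_all2_induct)
  case Nil
  then show ?case by (simp add: exchangeable_def)
next
  case (Cons C Cs D Ds)
  have D: "Fun g (Bs @ D # Cs) \<in> ctxts F"
    using Cons.hyps(1) Cons.prems by (auto simp: exchangeable_def)
  have "replace_at p (Fun g (Bs @ D # Cs)) E \<in> LL"
    if E: "E \<in> ctxts F" "p \<in> poss E" "replace_at p (Fun g (Bs @ C # Cs)) E \<in> LL" for E p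
  proof -
    let ?E = "replace_at p (Fun g (Bs @ C # Cs)) E"
    have "?E \<in> ctxts F"
      using E(1,2) Cons.prems by (intro replace_at_terms) auto
    moreover have "p @ [length Bs] \<in> poss ?E"
      using E(2) by (simp add: poss_append)
    moreover have "replace_at (p @ [length Bs]) X ?E = replace_at p (Fun g (Bs @ X # Cs)) E" for X
      using E(2) by (simp add: replace_at_append)
    ultimately show ?thesis
      using Cons.hyps(1) E(3) unfolding exchangeable_def by metis
  qed
  then have "exchangeable (Fun g (Bs @ C # Cs)) (Fun g (Bs @ D # Cs))"
    using D Cons.prems unfolding exchangeable_def by blast
  moreover have "exchangeable (Fun g (Bs @ D # Cs)) (Fun g (Bs @ D # Ds))"
    using Cons.IH[of "Bs @ [D]"] D by simp
  ultimately show ?case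
    unfolding exchangeable_def by blast
qed

lemma exchangeable_fill_Var:
  assumes "matches C t" "t \<in> terms F"
  shows "exchangeable C (ctxt_of (fill id (\<lambda>s. Var (x s)) C t))"
  using assms
proof (induction rule: matches.induct)
  case (hole t)
  then show ?case
    by (auto simp: exchangeable_def intro: LL_Var_hole)
next
  case (Var y)
  then show ?case
    by (simp add: exchangeable_def)
next
  case (Fun Cs ts f)
  let ?Ds = "map (\<lambda>i. ctxt_of (fill id (\<lambda>s. Var (x s)) (Cs ! i) (ts ! i))) [0..<length Cs]"
  have *: "list_all2 exchangeable Cs ?Ds"
    using Fun by (auto simp: list_all2_conv_all_nth id_def)
  then have "Fun (HSym f) Cs \<in> ctxts F"
    using Fun.hyps Fun.prems by (auto simp: list_all2_conv_all_nth exchangeable_def in_set_conv_nth)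
  from exchangeable_args[OF *, of "HSym f" "[]"] this
  show ?case
    by (simp add: comp_def id_def)
qed

text \<open>Naming the aliens by variables yields a term of rank one. The variables are arbitrary
  and may coincide.\<close>

lemma fill_Var_LL:
  assumes "C \<in> LL" "matches C t" "t \<in> terms F"
  shows "ctxt_of (fill id (\<lambda>s. Var (x s)) C t) \<in> LL"
  using exchangeable_fill_Var[OF assms(2,3), of x] assms(1) LL_ctxts[OF assms(1)]
  unfolding exchangeable_def by (metis poss_Nil replace_at.simps(1))

end

section \<open>Joining peaks through rank-one terms\<close>

locale layered_rank_one = layered_trs F LL R
  for F :: "'f sig" and LL :: "('f, 'v) ctxt set" and R :: "('f, 'v) trs" +
  assumes infinite_vars: "infinite (UNIV :: 'v set)"
    and rank_one: "confluent_on (rank_one_terms F LL) (rstep F R)"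
    and bounded: "bounded_duplicating F R"
begin

text \<open>Closure of the rank-one terms under steps lets confluence of the restricted relation be
  applied to unrestricted reductions.\<close>

lemma rank_one_steps:
  assumes "(rstep F R)\<^sup>*\<^sup>* s t" "s \<in> rank_one_terms F LL"
  shows "t \<in> rank_one_terms F LL \<and>
    (\<lambda>s t. s \<in> rank_one_terms F LL \<and> t \<in> rank_one_terms F LL \<and> rstep F R s t)\<^sup>*\<^sup>* s t"
  using assms
proof (induction rule: rtranclp_induct)
  case (step u v)
  then have "u \<in> rank_one_terms F LL" "v \<in> rank_one_terms F LL"
    using rank_one unfolding confluent_on_def by blast+
  then show ?case
    using step by (auto intro: rtranclp.rtrancl_into_rtrancl)
qed auto

lemma rank_one_confluent:
  assumes "s \<in> rank_one_terms F LL" "(rstep F R)\<^sup>*\<^sup>* s t" "(rstep F R)\<^sup>*\<^sup>* s u"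
  obtains z where "(rstep F R)\<^sup>*\<^sup>* t z" "(rstep F R)\<^sup>*\<^sup>* u z" "z \<in> terms F"
proof -
  let ?r = "\<lambda>s t. s \<in> rank_one_terms F LL \<and> t \<in> rank_one_terms F LL \<and> rstep F R s t"
  have "?r\<^sup>*\<^sup>* s t" "?r\<^sup>*\<^sup>* s u"
    using rank_one_steps assms by blast+
  moreover have "confluentp ?r"
    using rank_one by (simp add: confluent_on_def)
  ultimately obtain z where z: "?r\<^sup>*\<^sup>* t z" "?r\<^sup>*\<^sup>* u z"
    by (meson confluentpD)
  have r: "(rstep F R)\<^sup>*\<^sup>* a b" if "?r\<^sup>*\<^sup>* a b" for a b
    using that by induction auto
  have "s \<in> terms F"
    using assms(1) by (simp add: rank_one_terms_def)
  then have "z \<in> terms F"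
    using assms(2) r[OF z(1)] rsteps_terms by blast
  then show thesis
    using that r z by blast
qed

definition joinable_from :: "('f, 'v) trm \<Rightarrow> bool" where
  "joinable_from t \<longleftrightarrow> (\<forall>u v. (rstep F R)\<^sup>*\<^sup>* t u \<longrightarrow> (rstep F R)\<^sup>*\<^sup>* t v \<longrightarrow>
    (\<exists>z. (rstep F R)\<^sup>*\<^sup>* u z \<and> (rstep F R)\<^sup>*\<^sup>* v z))"

lemma layered_paths_joinable:
  assumes t: "t \<in> terms F" and paths: "layered_path t L1 u1" "layered_path t L2 u2"
    and IH: "\<And>s. s \<in> terms F \<Longrightarrow> diamond_depth (mark s) < diamond_depth (mark t) \<Longrightarrow> joinable_from s"
  shows "\<exists>z. (rstep F R)\<^sup>*\<^sup>* u1 z \<and> (rstep F R)\<^sup>*\<^sup>* u2 z"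
proof -
  obtain S1 where S1: "finite S1" "aliens L1 u1 \<subseteq> S1" "\<forall>s\<in>S1. s \<in> terms F \<and> diamond_depth (mark s) < diamond_depth (mark t)"
    "\<And>h. (\<forall>s\<in>S1. h s \<in> terms F) \<Longrightarrow> (\<forall>s\<in>S1. \<forall>s'\<in>S1. rstep F R s s' \<longrightarrow> h s = h s') \<Longrightarrow>
      (rstep F R)\<^sup>*\<^sup>* (fill id h (max_top t) t) (fill id h L1 u1)"
    using layered_path_sim[OF paths(1) t] by metis
  obtain S2 where S2: "finite S2" "aliens L2 u2 \<subseteq> S2" "\<forall>s\<in>S2. s \<in> terms F \<and> diamond_depth (mark s) < diamond_depth (mark t)"
    "\<And>h. (\<forall>s\<in>S2. h s \<in> terms F) \<Longrightarrow> (\<forall>s\<in>S2. \<forall>s'\<in>S2. rstep F R s s' \<longrightarrow> h s = h s') \<Longrightarrow>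
      (rstep F R)\<^sup>*\<^sup>* (fill id h (max_top t) t) (fill id h L2 u2)"
    using layered_path_sim[OF paths(2) t] by metis
  \<comment> \<open>Taking the aliens of both paths together gives one witness function
    \<open>w\<close> for both sides of the peak.\<close>
  define S where "S = S1 \<union> S2"
  have S: "finite S" "S \<subseteq> {s \<in> terms F. diamond_depth (mark s) < diamond_depth (mark t)}"
    using S1(1,3) S2(1,3) by (auto simp: S_def)
  have "\<exists>w. (\<forall>s\<in>S. (rstep F R)\<^sup>*\<^sup>* s (w s)) \<and> (\<forall>s\<in>S. \<forall>s'\<in>S. rstep F R s s' \<longrightarrow> w s = w s')"
  proof (rule ex_witness[OF S(1) _ S(2)])
    fix s x y
    assume "s \<in> {s \<in> terms F. diamond_depth (mark s) < diamond_depth (mark t)}" "(rstep F R)\<^sup>*\<^sup>* s x" "(rstep F R)\<^sup>*\<^sup>* s y"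
    then show "\<exists>z. (rstep F R)\<^sup>*\<^sup>* x z \<and> (rstep F R)\<^sup>*\<^sup>* y z"
      using IH[of s] unfolding joinable_from_def by blast
  qed
  then obtain w where w: "\<And>s. s \<in> S \<Longrightarrow> (rstep F R)\<^sup>*\<^sup>* s (w s)"
    "\<And>s s'. s \<in> S \<Longrightarrow> s' \<in> S \<Longrightarrow> rstep F R s s' \<Longrightarrow> w s = w s'"
    by blast
  have w_terms: "w s \<in> terms F" if "s \<in> S" for s
    using that S(2) w(1) rsteps_terms by blast
  have "infinite (UNIV - vars_of t)"
    using infinite_vars finite_vars_of by (simp add: Diff_infinite_finite)
  \<comment> \<open>One fresh variable is reserved for each witness. Freshness keeps
    \<open>\<sigma>\<close> from touching the variables of \<open>t\<close>.\<close>
  then obtain V where V: "finite V" "card V = card (w ` S)" "V \<subseteq> UNIV - vars_of t"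
    by (meson infinite_arbitrarily_large)
  then obtain v where v: "bij_betw v (w ` S) V"
    using S(1) by (metis finite_imageI finite_same_card_bij)
  define \<sigma> where "\<sigma> y = (if y \<in> V then inv_into (w ` S) v y else Var y)" for y
  have \<sigma>_v: "\<sigma> (v (w s)) = w s" if "s \<in> S" for s
    using that v by (auto simp: \<sigma>_def bij_betw_def)
  have \<sigma>_id: "\<sigma> y = Var y" if "y \<in> vars_of t" for y
    using that V(3) by (auto simp: \<sigma>_def)
  have \<sigma>_terms: "\<sigma> y \<in> terms F" for y
  proof (cases "y \<in> V")
    case True
    then have "\<sigma> y \<in> w ` S"
      using v by (auto simp: \<sigma>_def bij_betw_def intro: inv_into_into)
    then show ?thesis
      using w_terms by auto
  qed (simp add: \<sigma>_def)
  \<comment> \<open>Aliens with the same witness get the same name, so steps between aliens become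
    invisible.\<close>
  let ?lab = "fill id (\<lambda>s. Var (v (w s)))"
  have v_eq: "Var (v (w s)) = Var (v (w s'))" if "s \<in> S" "s' \<in> S" "rstep F R s s'" for s s'
    using w(2)[OF that] by simp
  have lab: "(rstep F R)\<^sup>*\<^sup>* (?lab (max_top t) t) (?lab L1 u1)" "(rstep F R)\<^sup>*\<^sup>* (?lab (max_top t) t) (?lab L2 u2)"
    by (rule S1(4), use v_eq in \<open>simp add: S_def\<close>, use v_eq in \<open>simp add: S_def\<close>)
      (rule S2(4), use v_eq in \<open>simp add: S_def\<close>, use v_eq in \<open>simp add: S_def\<close>)
  have "?lab (max_top t) t \<in> rank_one_terms F LL"
    using t fill_Var_LL[OF max_top_LL matches_max_top, of t "\<lambda>s. v (w s)"]
    by (auto simp: rank_one_terms_def intro!: fill_terms matches_max_top)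
  then obtain z where z: "(rstep F R)\<^sup>*\<^sup>* (?lab L1 u1) z" "(rstep F R)\<^sup>*\<^sup>* (?lab L2 u2) z"
    using lab by (rule rank_one_confluent)
  \<comment> \<open>Reducing each alien to its witness gives the \<open>\<sigma>\<close>-instance of
    the labelled term, from which the instantiated reduction to \<open>z\<close> continues.\<close>
  have reach: "(rstep F R)\<^sup>*\<^sup>* u (subst \<sigma> z)"
    if path: "layered_path t L u" and al: "aliens L u \<subseteq> S" and z: "(rstep F R)\<^sup>*\<^sup>* (?lab L u) z" for L u
  proof -
    note inv = layered_path_invs[OF path t]
    have "(rstep F R)\<^sup>*\<^sup>* u (fill id w L u)"
      using inv al w(1) by (intro rsteps_fill) auto
    also have "fill id w L u = subst \<sigma> (?lab L u)"
      using inv al \<sigma>_v \<sigma>_id by (intro subst_fill[symmetric]) auto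
    also have "(rstep F R)\<^sup>*\<^sup>* \<dots> (subst \<sigma> z)"
      using z \<sigma>_terms by (rule rsteps_subst)
    finally show ?thesis .
  qed
  show ?thesis
    using reach[OF paths(1) _ z(1)] reach[OF paths(2) _ z(2)] S1(2) S2(2) by (auto simp: S_def)
qed

text \<open>Aliens have smaller depth, and after a fusion the marked term is smaller with respect to
  \<open>desc\<close>. As the depth does not grow along \<open>desc\<close>, both are smaller in the
  lexicographic order.\<close>

lemma joinable_from_terms: "t \<in> terms F \<Longrightarrow> joinable_from t"
proof (induction "(diamond_depth (mark t), mark t)" arbitrary: t
    rule: wf_induct_rule[OF wf_lex_prod[OF wf_less_than wf_desc[OF bounded]]])
  case (1 t)
  have desc: "joinable_from s" if "s \<in> terms F" "desc F R (mark t) (mark s)" for s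
  proof (rule "1.hyps"[OF _ that(1)])
    have "(ext_step F R)\<^sup>*\<^sup>* (mark t) (mark s)"
      using that(2) rstep_mono[of "diamond_sig F" "range diamond_rule" _ _ "diamond_trs R \<union> range diamond_rule"]
      by (elim relcomppE) (meson Un_upper2 rtranclp.rtrancl_into_rtrancl rtranclp_trans)
    then have "diamond_depth (mark s) \<le> diamond_depth (mark t)"
      by (rule diamond_depth_ext_steps[OF trs])
    then show "((diamond_depth (mark s), mark s), diamond_depth (mark t), mark t) \<in> less_than <*lex*> {(m', m). desc F R m m'}"
      using that(2) by auto
  qed
  have small: "joinable_from s" if "s \<in> terms F" "diamond_depth (mark s) < diamond_depth (mark t)" for s
    by (rule "1.hyps"[OF _ that(1)]) (use that(2) in simp)
  show ?case
    unfolding joinable_from_def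
  proof (intro allI impI)
    fix u v
    assume "(rstep F R)\<^sup>*\<^sup>* t u" "(rstep F R)\<^sup>*\<^sup>* t v"
    then obtain L1 u' L2 v' where paths: "layered_path t L1 u'" "layered_path t L2 v'"
      and u': "(rstep F R)\<^sup>*\<^sup>* u' u" "u' = u \<or> desc F R (mark t) (mark u')"
      and v': "(rstep F R)\<^sup>*\<^sup>* v' v" "v' = v \<or> desc F R (mark t) (mark v')"
      using layered_path_decompose "1.prems" by meson
    have terms: "u' \<in> terms F" "v' \<in> terms F"
      using layered_path_invs paths "1.prems" by blast+
    obtain z where z: "(rstep F R)\<^sup>*\<^sup>* u' z" "(rstep F R)\<^sup>*\<^sup>* v' z"
      using layered_paths_joinable[OF "1.prems" paths small] by blast
    \<comment> \<open>A side without fusion is already at its end; otherwise the induction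
      hypothesis applies to the term after the fusion. The two sides are completed one after the
      other.\<close>
    obtain y where y: "(rstep F R)\<^sup>*\<^sup>* u y" "(rstep F R)\<^sup>*\<^sup>* z y"
      using u'(2)
    proof
      assume "desc F R (mark t) (mark u')"
      from desc[OF terms(1) this] show ?thesis
        using u'(1) z(1) that unfolding joinable_from_def by blast
    qed (use z(1) that in blast)
    have "(rstep F R)\<^sup>*\<^sup>* v' y"
      using z(2) y(2) by (rule rtranclp_trans)
    then obtain x where "(rstep F R)\<^sup>*\<^sup>* v x" "(rstep F R)\<^sup>*\<^sup>* y x"
      using v'(2)
    proof (elim disjE)
      assume "(rstep F R)\<^sup>*\<^sup>* v' y" "desc F R (mark t) (mark v')"
      from desc[OF terms(2) this(2)] this(1) show ?thesis
        using v'(1) that unfolding joinable_from_def by blast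
    qed (use that in blast)
    then show "\<exists>z. (rstep F R)\<^sup>*\<^sup>* u z \<and> (rstep F R)\<^sup>*\<^sup>* v z"
      using y(1) by (meson rtranclp_trans)
  qed
qed

lemma confluentp_rstep: "confluentp (rstep F R)"
proof (rule confluentpI)
  fix t u v
  assume tu: "(rstep F R)\<^sup>*\<^sup>* t u" and tv: "(rstep F R)\<^sup>*\<^sup>* t v"
  show "\<exists>z. (rstep F R)\<^sup>*\<^sup>* u z \<and> (rstep F R)\<^sup>*\<^sup>* v z"
  proof (cases "t \<in> terms F")
    case True
    then show ?thesis
      using joinable_from_terms tu tv unfolding joinable_from_def by blast
  next
    case False
    have "u = t"
      using tu by (cases rule: converse_rtranclpE) (use False in \<open>auto simp: rstep_def\<close>)
    then show ?thesis
      using tv by blast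
  qed
qed

end

theorem theorem4p3:
  fixes F :: "'f sig" and LL :: "('f, 'v) ctxt set" and R :: "('f, 'v) trs"
  assumes "infinite (UNIV :: 'v set)" and "countable (UNIV :: 'v set)"
    and "layer_system F LL"
    and "is_trs F R"
    and "weakly_layered F LL R"
    and "confluent_on (rank_one_terms F LL) (rstep F R)"
    and "bounded_duplicating F R"
  shows "confluentp (rstep F R)"
proof -
  interpret layered_rank_one F LL R
    by unfold_locales (fact assms)+
  show ?thesis
    by (rule confluentp_rstep)
qed

end
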